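(* Let $n\in\mathbb{N}$, let $0<s<2\pi$, and let $Q(x)=\sum_{|k|\le n}c_ke^{ikx}$, $c_k\in\mathbb{C}$, be a complex trigonometric polynomial of degree at most $n$ such that $$\left|\{x\in[0,2\pi):\ |Q(x)|\le 1\}\right|\ge 2\pi-s .$$ Then $$\|Q\|_{C[0,2\pi)}\le \mathfrak{T}_{2n}\left(\sec\frac s4\right).$$ Moreover, equality holds if and only if $$Q(x)=e^{ic_1}\,\mathfrak{T}_{2n}\left(\sec\frac s4\,\cos\frac{x-c_0}{2}\right)$$ for some $c_0,c_1\in\mathbb{R}$.
   Context: $|B|$ denotes the Lebesgue measure of a measurable set $B$. $\|Q\|_{C[0,2\pi)}=\sup_{x\in[0,2\pi)}|Q(x)|$. $\mathfrak{T}_m$ denotes the Chebyshev polynomial (of the first kind) of degree $m$, i.e. $\mathfrak{T}_m(x)=\frac12\big((x+\sqrt{x^2-1})^m+(x-\sqrt{x^2-1})^m\big)$, equivalently the polynomial with $\mathfrak{T}_m(\cos t)=\cos mt$. *)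

theory Defs
  imports "HOL-Analysis.Analysis"
begin

(* Chebyshev polynomial of the first kind, as a function on the reals. For
   \<bar>x\<bar> < 1 the radicand is negative, so the root is taken in the complex numbers
   (the sum does not depend on the branch); the sum is real for every real x
   (chebyshev_closed_form), so Re discards nothing. *)
definition chebyshev :: "nat \<Rightarrow> real \<Rightarrow> real" where
  "chebyshev m x =
     Re (((of_real x + csqrt (of_real x ^ 2 - 1)) ^ m + (of_real x - csqrt (of_real x ^ 2 - 1)) ^ m) / 2)"

lemma chebyshev_closed_form:
  "complex_of_real (chebyshev m x) =
     ((of_real x + csqrt (of_real x ^ 2 - 1)) ^ m + (of_real x - csqrt (of_real x ^ 2 - 1)) ^ m) / 2"
proof -
  define w where "w = csqrt (complex_of_real x ^ 2 - 1)"
  define z where "z = (complex_of_real x + w) ^ m + (complex_of_real x - w) ^ m"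
  have w2: "w ^ 2 = complex_of_real (x ^ 2 - 1)"
    by (simp add: w_def)
  have "cnj w ^ 2 = w ^ 2"
    by (metis w2 complex_cnj_complex_of_real complex_cnj_power)
  then have "cnj w = w \<or> cnj w = - w"
    by (simp add: power2_eq_iff)
  then have "cnj z = z"
    by (auto simp: z_def)
  then have "Im z = 0"
    by (simp add: complex_eq_iff)
  then have "complex_of_real (Re (z / 2)) = z / 2"
    by (simp add: complex_eq_iff)
  then show ?thesis
    by (simp add: chebyshev_def z_def w_def)
qed

lemma chebyshev_cos: "chebyshev m (cos t) = cos (real m * t)"
proof -
  define w where "w = csqrt (complex_of_real (cos t) ^ 2 - 1)"
  have "complex_of_real (cos t) ^ 2 - 1 = (\<i> * complex_of_real (sin t)) ^ 2"
    by (simp add: power_mult_distrib cos_squared_eq flip: of_real_power)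
  then have "w ^ 2 = (\<i> * complex_of_real (sin t)) ^ 2"
    by (simp add: w_def)
  then have "w = \<i> * complex_of_real (sin t) \<or> w = - (\<i> * complex_of_real (sin t))"
    by (simp add: power2_eq_iff)
  moreover have "complex_of_real (cos t) + \<i> * complex_of_real (sin t) = cis t"
    "complex_of_real (cos t) - \<i> * complex_of_real (sin t) = cis (- t)"
    by (simp_all add: complex_eq_iff)
  ultimately have "(complex_of_real (cos t) + w) ^ m + (complex_of_real (cos t) - w) ^ m
      = cis (real m * t) + cis (- (real m * t))"
    by (auto simp: Complex.DeMoivre)
  then show ?thesis
    by (simp add: chebyshev_def w_def)
qed

end

(*
  Proof idea. Replacing Q by Re (u Q(x + x0)), with |u| = 1 and x0 a maximum point of |Q|, reduces the
  inequality to real trigonometric polynomials P that attain max |P| at 0. By compactness there is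
  an extremal P; let M = P 0 > 1 and E = {|P| <= 1}. Suppose P has a critical point z in (0, 2 pi)
  with |P z| > 1. The field f(x) = - cot((x - z)/2) - eta cot(x/2)^k has f' >= 0 on E if eta is
  small, so x + eps f(x) does not decrease the measure of E; and since P' vanishes at z, and at 0 to
  order k, the function P - eps P' f is again a trigonometric polynomial of degree n. It equals P up
  to O(eps^2) along the displaced points of E, while its value at 0 exceeds M by a positive multiple
  of eps. After rescaling it contradicts extremality. Hence |P| > 1 holds on a single arc only, E is
  an arc, and Lagrange interpolation at the 2n + 1 alternation points of the Chebyshev-type
  polynomial of that arc gives the bound together with its equality case. For complex Q, equality
  forces the imaginary part of u Q(x + x0) to vanish at these 2n + 1 points, hence identically.
*)
theory Submission
  imports Defs "HOL-Complex_Analysis.Great_Picard"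
begin

subsection \<open>Real trigonometric polynomials\<close>

text \<open>Raising \<open>P 0\<close> and preserving the measure of \<open>E\<close> pull against
  each other. Since \<open>P\<close> has its maximum at 0, \<open>P'\<close> vanishes there to an
  odd order \<open>k\<close>, changing sign from plus to minus. The \<open>\<eta>\<close> that
  raises \<open>P 0\<close> is therefore negative, and then - \<eta> cot(x/2)^k decreases on (0, 2
  pi): this term alone would shrink \<open>E\<close>. The second pole \<open>z\<close> pays for the
  loss: - cot((x - z)/2) has derivative at least 1/2 and contributes nothing at 0, because
  \<open>P' 0 = 0\<close>. Cotangents are the right fields since multiplication by cot((x - z)/2)
  preserves the degree of a trigonometric polynomial that vanishes at \<open>z\<close>. The constant
  comes from the arc case. The scaling sec(s/4) is the one for which sec(s/4) cos((x - c)/2) runs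
  through [-1, 1] exactly on the arc from c + s/2 to c + 2 pi - s/2; at the centre c of the gap it
  takes the value sec(s/4).\<close>

text \<open>Multiplication by \<open>cis x ^ n\<close> clears the negative frequencies, so that root
  counting, orders of zeros and division can be borrowed from \<open>complex poly\<close>. The
  symmetry of the coefficients is implied by \<open>f\<close> being real-valued.\<close>

definition trig :: "nat \<Rightarrow> (real \<Rightarrow> real) set" where
  "trig n = {f. \<exists>p::complex poly. degree p \<le> 2 * n \<and>
     (\<forall>x. of_real (f x) * cis x ^ n = poly p (cis x))}"

lemma trigI:
  assumes "degree p \<le> 2 * n" "\<And>x. of_real (f x) * cis x ^ n = poly p (cis x)"
  shows "f \<in> trig n"
  using assms by (auto simp: trig_def)

lemma trigE:
  assumes "f \<in> trig n"
  obtains p where "degree p \<le> 2 * n" "\<And>x. of_real (f x) * cis x ^ n = poly p (cis x)"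
  using assms by (auto simp: trig_def)

lemma cis_cnj_mult: "cis x * cnj (cis x) = 1"
  by (simp add: complex_eq_iff power2_eq_square[symmetric])

text \<open>On the unit circle the conjugate of w is 1/w. Hence the conjugate of \<open>G\<close> is
  represented by the reciprocal polynomial \<open>q\<close>, whose coefficients are those of
  \<open>p\<close> conjugated and reversed, and \<open>Re (G x)\<close> by half the sum of
  \<open>p\<close> and \<open>q\<close>.\<close>

lemma trig_Re:
  fixes G :: "real \<Rightarrow> complex"
  assumes deg: "degree p \<le> 2 * n" and G: "\<And>x. G x * cis x ^ n = poly p (cis x)"
  shows "(\<lambda>x. Re (G x)) \<in> trig n"
proof -
  define q where "q = (\<Sum>k\<le>2*n. monom (cnj (coeff p k)) (2*n-k))"
  have degq: "degree q \<le> 2 * n"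
    unfolding q_def by (intro degree_sum_le) (auto intro: order.trans[OF degree_monom_le])
  have q: "cnj (G x) * cis x ^ n = poly q (cis x)" for x
  proof -
    have "cnj (G x) = cnj (G x) * (cis x * cnj (cis x)) ^ n"
      by (simp add: cis_cnj_mult)
    also have "\<dots> = cnj (G x * cis x ^ n) * cis x ^ n"
      by (simp add: power_mult_distrib)
    also have "G x * cis x ^ n = (\<Sum>k\<le>2*n. coeff p k * cis x ^ k)"
      unfolding G poly_altdef using deg
      by (intro sum.mono_neutral_left) (auto simp: coeff_eq_0)
    finally have "cnj (G x) * cis x ^ n
        = (\<Sum>k\<le>2*n. cnj (coeff p k) * cnj (cis x) ^ k) * cis x ^ n * cis x ^ n"
      by (simp add: mult.assoc)
    also have "\<dots> = (\<Sum>k\<le>2*n. cnj (coeff p k) * cnj (cis x) ^ k * cis x ^ (2*n))"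
      by (simp only: sum_distrib_right mult.assoc mult_2 power_add)
    also have "\<dots> = (\<Sum>k\<le>2*n. cnj (coeff p k) * cis x ^ (2*n-k))"
    proof (rule sum.cong[OF refl])
      fix k assume "k \<in> {..2*n}"
      then have "cis x ^ (2*n) = cis x ^ k * cis x ^ (2*n-k)"
        by (simp flip: power_add)
      then have "cnj (cis x) ^ k * cis x ^ (2*n) = (cis x * cnj (cis x)) ^ k * cis x ^ (2*n-k)"
        by (simp add: power_mult_distrib mult_ac)
      then show "cnj (coeff p k) * cnj (cis x) ^ k * cis x ^ (2*n) = cnj (coeff p k) * cis x ^ (2*n-k)"
        by (simp add: cis_cnj_mult mult.assoc)
    qed
    finally show ?thesis by (simp add: q_def poly_sum poly_monom)
  qed
  show ?thesis
  proof (rule trigI)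
    show "degree (smult (1/2) (p + q)) \<le> 2 * n"
      using deg degq by (simp add: degree_add_le)
    show "of_real (Re (G x)) * cis x ^ n = poly (smult (1/2) (p + q)) (cis x)" for x
    proof -
      have "complex_of_real (Re (G x)) = (G x + cnj (G x)) / 2"
        by (simp add: complex_eq_iff)
      then have "of_real (Re (G x)) * cis x ^ n = (G x * cis x ^ n + cnj (G x) * cis x ^ n) / 2"
        by (simp only: distrib_right times_divide_eq_left)
      then show ?thesis unfolding G q by simp
    qed
  qed
qed

lemma trig_const: "(\<lambda>x. c) \<in> trig n"
  by (rule trigI[of "monom (of_real c) n"]) (auto simp: poly_monom degree_monom_eq intro: order.trans[OF degree_monom_le])

lemma trig_add:
  assumes "f \<in> trig n" "g \<in> trig n"
  shows "(\<lambda>x. f x + g x) \<in> trig n"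
proof -
  obtain p where p: "degree p \<le> 2 * n" "\<And>x. of_real (f x) * cis x ^ n = poly p (cis x)"
    using assms(1) by (rule trigE) blast
  obtain q where q: "degree q \<le> 2 * n" "\<And>x. of_real (g x) * cis x ^ n = poly q (cis x)"
    using assms(2) by (rule trigE) blast
  show ?thesis
    by (rule trigI[of "p + q"]) (use p q in \<open>auto simp: degree_add_le ring_distribs\<close>)
qed

lemma trig_cmult:
  assumes "f \<in> trig n"
  shows "(\<lambda>x. c * f x) \<in> trig n"
proof -
  obtain p where p: "degree p \<le> 2 * n" "\<And>x. of_real (f x) * cis x ^ n = poly p (cis x)"
    using assms(1) by (rule trigE) blast
  show ?thesis
    by (rule trigI[of "smult (of_real c) p"])
      (use p in \<open>auto simp: mult.assoc intro: order.trans[OF degree_smult_le]\<close>)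
qed

lemma trig_diff:
  assumes "f \<in> trig n" "g \<in> trig n"
  shows "(\<lambda>x. f x - g x) \<in> trig n"
  using trig_add[OF assms(1) trig_cmult[OF assms(2), of "-1"]] by simp

lemma trig_sum:
  assumes "\<And>i. i \<in> I \<Longrightarrow> f i \<in> trig n"
  shows "(\<lambda>x. \<Sum>i\<in>I. f i x) \<in> trig n"
  using assms by (induction I rule: infinite_finite_induct) (auto intro: trig_const trig_add)

lemma trig_mult:
  assumes "f \<in> trig m" "g \<in> trig n"
  shows "(\<lambda>x. f x * g x) \<in> trig (m + n)"
proof -
  obtain p where p: "degree p \<le> 2 * m" "\<And>x. of_real (f x) * cis x ^ m = poly p (cis x)"
    using assms(1) by (rule trigE) blast
  obtain q where q: "degree q \<le> 2 * n" "\<And>x. of_real (g x) * cis x ^ n = poly q (cis x)"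
    using assms(2) by (rule trigE) blast
  show ?thesis
  proof (rule trigI)
    show "degree (p * q) \<le> 2 * (m + n)"
      using p(1) q(1) degree_mult_le[of p q] by simp
    show "of_real (f x * g x) * cis x ^ (m + n) = poly (p * q) (cis x)" for x
      by (simp add: power_add flip: p(2) q(2))
  qed
qed

lemma trig_shift:
  assumes "f \<in> trig n"
  shows "(\<lambda>x. f (x + a)) \<in> trig n"
proof -
  obtain p where p: "degree p \<le> 2 * n" "\<And>x. of_real (f x) * cis x ^ n = poly p (cis x)"
    using assms(1) by (rule trigE) blast
  show ?thesis
  proof (rule trigI)
    let ?q = "smult (cis (-a) ^ n) (pcompose p [:0, cis a:])"
    have "degree ?q \<le> degree p"
      by (intro order.trans[OF degree_smult_le]) (use degree_pcompose_le[of p "[:0, cis a:]"] in simp)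
    then show "degree ?q \<le> 2 * n" using p(1) by simp
    show "of_real (f (x + a)) * cis x ^ n = poly ?q (cis x)" for x
    proof -
      have "cis x = cis (-a) * cis (x + a)" by (simp add: cis_mult)
      then have "of_real (f (x + a)) * cis x ^ n = cis (-a) ^ n * (of_real (f (x + a)) * cis (x + a) ^ n)"
        by (simp add: power_mult_distrib)
      then show ?thesis unfolding p by (simp add: poly_pcompose cis_mult)
    qed
  qed
qed

lemma trig_mono_deg:
  assumes "f \<in> trig m" "m \<le> n"
  shows "f \<in> trig n"
  using trig_mult[OF assms(1) trig_const[of 1 "n - m"]] assms(2) by simp

lemma cos_in_trig: "(\<lambda>x. cos (x - a)) \<in> trig 1"
proof -
  have "(\<lambda>x. Re (cis (x - a))) \<in> trig 1"
    by (rule trig_Re[of "monom (cis (-a)) 2"])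
      (auto simp: poly_monom cis_mult power2_eq_square algebra_simps intro: order.trans[OF degree_monom_le])
  then show ?thesis by simp
qed

text \<open>A single half-angle sine changes sign under a shift by 2 pi and belongs to no
  \<open>trig n\<close>. Two of them multiply to a constant minus a cosine of the full angle, of
  degree 1; this is why the number of factors is even.\<close>

lemma prod_sin_in_trig:
  assumes "finite A" "card A = 2 * m"
  shows "(\<lambda>x. \<Prod>j\<in>A. sin ((x - t j) / 2)) \<in> trig m"
  using assms
proof (induction m arbitrary: A)
  case 0
  then show ?case by (simp add: trig_const)
next
  case (Suc m)
  obtain a where a: "a \<in> A" using Suc.prems by fastforce
  then have card: "card (A - {a}) = Suc (2 * m)" using Suc.prems by simp
  then have "A - {a} \<noteq> {}" by (metis card.empty nat.distinct(1))
  then obtain b where b: "b \<in> A - {a}" by blast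
  define B where "B = A - {a} - {b}"
  have cB: "finite B" "card B = 2 * m"
    using Suc.prems a b by (auto simp: B_def)
  have A: "A = insert a (insert b B)" "a \<notin> insert b B" "b \<notin> B" using a b by (auto simp: B_def)
  have eq: "sin ((x - t a) / 2) * sin ((x - t b) / 2)
      = (1/2) * (cos ((t b - t a) / 2) - cos (x - (t a + t b) / 2))" for x
    by (simp add: sin_times_sin field_simps) (simp add: add_divide_distrib diff_divide_distrib algebra_simps)
  have "(\<lambda>x. (1/2) * (cos ((t b - t a) / 2) - cos (x - (t a + t b) / 2))) \<in> trig 1"
    by (intro trig_cmult trig_diff trig_const cos_in_trig)
  from trig_mult[OF this Suc.IH[OF cB]]
  show ?case unfolding eq[symmetric] using A cB
    by (simp add: mult.assoc)
qed

section \<open>Zeros, derivatives and bounds of trigonometric polynomials\<close>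

lemma inj_on_cis: "inj_on cis {0..<2*pi}"
proof (rule inj_onI)
  fix x y assume xy: "x \<in> {0..<2*pi}" "y \<in> {0..<2*pi}" "cis x = cis y"
  then have "sin x = sin y \<and> cos x = cos y" by (simp add: complex_eq_iff)
  then obtain k :: int where k: "x = y + 2 * pi * k" using sin_cos_eq_iff by blast
  have "\<bar>2 * pi * real_of_int k\<bar> < 2 * pi * 1" using xy k by auto
  then have "\<bar>real_of_int k\<bar> < 1" unfolding abs_mult by simp
  then have "k = 0" by linarith
  then show "x = y" using k by simp
qed

text \<open>Distinct points of [0, 2 pi) give distinct roots of \<open>p\<close> on the unit circle,
  and a nonzero \<open>p\<close> has at most 2n roots.\<close>

lemma trig_eq_0:
  assumes f: "f \<in> trig n" and S: "finite S" "S \<subseteq> {0..<2*pi}" "card S > 2 * n"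
    and z: "\<And>x. x \<in> S \<Longrightarrow> f x = 0"
  shows "f x = 0"
proof -
  obtain p where p: "degree p \<le> 2 * n" "\<And>x. of_real (f x) * cis x ^ n = poly p (cis x)"
    using f by (rule trigE) blast
  have "p = 0"
  proof (rule ccontr)
    assume "p \<noteq> 0"
    have "cis ` S \<subseteq> {w. poly p w = 0}" using z by (auto simp flip: p(2))
    then have "card (cis ` S) \<le> card {w. poly p w = 0}"
      by (intro card_mono) (auto simp: poly_roots_finite \<open>p \<noteq> 0\<close>)
    also have "\<dots> \<le> degree p" using card_poly_roots_bound[OF \<open>p \<noteq> 0\<close>] .
    finally show False using p(1) S card_image[OF inj_on_subset[OF inj_on_cis S(2)]] by simp
  qed
  then show ?thesis using p(2)[of x] by simp
qed

lemma trig_cong_points: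
  assumes "f \<in> trig n" "g \<in> trig n" "finite S" "S \<subseteq> {0..<2*pi}" "card S > 2 * n"
    and "\<And>x. x \<in> S \<Longrightarrow> f x = g x"
  shows "f x = g x"
  using trig_eq_0[OF trig_diff[OF assms(1,2)] assms(3-5), of x] assms(6) by simp

lemma trig_periodic:
  assumes "f \<in> trig n"
  shows "f (x + 2 * pi) = f x"
proof -
  obtain p where p: "\<And>x. of_real (f x) * cis x ^ n = poly p (cis x)"
    using assms by (rule trigE) blast
  have "cis (x + 2 * pi) = cis x" by (simp add: complex_eq_iff)
  then have "of_real (f (x + 2 * pi)) * cis x ^ n = of_real (f x) * cis x ^ n"
    using p[of x] p[of "x + 2 * pi"] by simp
  then show ?thesis by simp
qed

lemma trig_derivative:
  assumes "f \<in> trig n"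
  obtains f' where "f' \<in> trig n" "\<And>x. (f has_real_derivative f' x) (at x)"
proof -
  obtain p where p: "degree p \<le> 2 * n" "\<And>x. of_real (f x) * cis x ^ n = poly p (cis x)"
    using assms by (rule trigE) blast
  define F where "F x = cis (-x) ^ n * poly p (cis x)" for x
  have f: "f x = Re (F x)" for x
  proof -
    have "F x = of_real (f x) * (cis x ^ n * cis (-x) ^ n)"
      by (simp add: F_def flip: p(2))
    then show ?thesis by (simp add: cis_mult flip: power_mult_distrib)
  qed
  define F' where "F' x = - of_nat n * \<i> * F x + cis (-x) ^ n * (poly (pderiv p) (cis x) * (\<i> * cis x))" for x
  have cis: "((\<lambda>x. cis (c * x)) has_vector_derivative (of_real c * \<i> * cis (c * x))) (at x)" for c x :: real
  proof -
    have "((\<lambda>w. exp (\<i> * (of_real c * w))) has_field_derivative of_real c * \<i> * cis (c * x)) (at (of_real x))"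
      by (auto intro!: derivative_eq_intros simp: cis_conv_exp)
    from has_vector_derivative_real_field[OF this, of UNIV] show ?thesis
      by (simp add: cis_conv_exp)
  qed
  have F: "F = (\<lambda>x. cis (- real n * x) * poly p (cis x))"
    by (simp add: F_def fun_eq_iff Complex.DeMoivre)
  have dp: "((\<lambda>x. poly p (cis x)) has_vector_derivative (\<i> * cis x * poly (pderiv p) (cis x))) (at x)" for x
    using field_vector_diff_chain_at[of cis "\<i> * cis x" x "poly p" "poly (pderiv p) (cis x)"]
      cis[of 1 x] poly_DERIV[of p "cis x"] by (simp add: o_def)
  have "(F has_vector_derivative F' x) (at x)" for x
    unfolding F
    apply (rule has_vector_derivative_eq_rhs[OF has_vector_derivative_mult[OF cis dp]])
    apply (simp add: F'_def F Complex.DeMoivre algebra_simps)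
    done
  then have "((\<lambda>x. Re (F x)) has_vector_derivative Re (F' x)) (at x)" for x
    by (rule bounded_linear.has_vector_derivative[OF bounded_linear_Re])
  then have "(f has_real_derivative Re (F' x)) (at x)" for x
    unfolding has_real_derivative_iff_has_vector_derivative f[abs_def] by simp
  moreover have "(\<lambda>x. Re (F' x)) \<in> trig n"
  proof (rule trig_Re)
    \<comment> \<open>This is the derivative of w^(-n) p(w) along w = \<open>cis x\<close>,
      multiplied by w^n. The \<open>pCons 0\<close> is the factor w from the derivative of
      \<open>cis\<close>; it makes up for the degree lost by \<open>pderiv\<close>.\<close>
    let ?q = "smult (- of_nat n * \<i>) p + smult \<i> (pCons 0 (pderiv p))"
    have "degree (pCons 0 (pderiv p)) \<le> 2 * n"
    proof (cases "degree p = 0")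
      case False
      then show ?thesis using p(1) degree_pCons_le[of 0 "pderiv p"] by (simp add: degree_pderiv)
    qed (simp add: pderiv_eq_0_iff)
    then show "degree ?q \<le> 2 * n"
      using p(1) by (intro degree_add_le order.trans[OF degree_smult_le])
    show "F' x * cis x ^ n = poly ?q (cis x)" for x
    proof -
      have c1: "cis (-x) ^ n * cis x ^ n = 1" by (simp add: cis_mult flip: power_mult_distrib)
      have "F' x * cis x ^ n = (cis (-x) ^ n * cis x ^ n) * poly ?q (cis x)"
        by (simp add: F'_def F_def algebra_simps)
      then show ?thesis using c1 by simp
    qed
  qed
  ultimately show ?thesis using that by blast
qed

lemma trig_continuous:
  assumes "f \<in> trig n"
  shows "continuous_on S f"
proof -
  obtain f' where "\<And>x. (f has_real_derivative f' x) (at x)"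
    using trig_derivative[OF assms] by metis
  then show ?thesis by (meson DERIV_isCont continuous_at_imp_continuous_on)
qed

lemma periodic_representative:
  fixes x a :: real
  obtains y and k :: int where "y \<in> {a..<a + 2 * pi}" "x = y + 2 * pi * k"
proof
  let ?k = "\<lfloor>(x - a) / (2 * pi)\<rfloor>"
  have 1: "of_int ?k \<le> (x - a) / (2 * pi)" and 2: "(x - a) / (2 * pi) < of_int ?k + 1"
    by linarith+
  have "of_int ?k * (2 * pi) \<le> x - a"
    using 1 by (subst (asm) pos_le_divide_eq) auto
  moreover have "x - a < (of_int ?k + 1) * (2 * pi)"
    using 2 by (subst (asm) pos_divide_less_eq) auto
  ultimately show "x - 2 * pi * ?k \<in> {a..<a + 2 * pi}" by (auto simp: algebra_simps)
  show "x = x - 2 * pi * ?k + 2 * pi * ?k" by simp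
qed

lemma periodic_int:
  fixes f :: "real \<Rightarrow> 'a"
  assumes "\<And>x. f (x + 2 * pi) = f x"
  shows "f (x + 2 * pi * of_int k) = f x"
proof -
  have nat: "f (x + 2 * pi * real m) = f x" for m x
  proof (induction m)
    case (Suc m)
    have "f (x + 2 * pi * real (Suc m)) = f ((x + 2 * pi * real m) + 2 * pi)"
      by (simp add: algebra_simps)
    then show ?case using Suc assms by simp
  qed simp
  show ?thesis
  proof (cases "k \<ge> 0")
    case True
    then show ?thesis using nat[of x "nat k"] by simp
  next
    case False
    then show ?thesis using nat[of "x + 2 * pi * of_int k" "nat (-k)"] by simp
  qed
qed

lemma trig_bounded:
  assumes "f \<in> trig n"
  obtains B where "B > 0" "\<And>x. \<bar>f x\<bar> \<le> B"
proof -
  have "compact (f ` {0..2*pi})"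
    by (intro compact_continuous_image trig_continuous[OF assms] compact_Icc)
  then obtain B where B: "B > 0" "\<And>y. y \<in> f ` {0..2*pi} \<Longrightarrow> norm y \<le> B"
    using compact_imp_bounded bounded_pos by metis
  have "\<bar>f x\<bar> \<le> B" for x
  proof -
    obtain y and k :: int where y: "y \<in> {0..<0 + 2 * pi}" "x = y + 2 * pi * k"
      by (rule periodic_representative) blast
    have "f x = f y" unfolding y(2) by (rule periodic_int) (rule trig_periodic[OF assms])
    then show ?thesis using B(2)[of "f y"] y(1) by auto
  qed
  then show ?thesis using B(1) that by blast
qed

section \<open>Multiplication by cotangents\<close>

lemma cis_diff_factor: "cis x - cis z = 2 * \<i> * of_real (sin ((x - z) / 2)) * cis ((x + z) / 2)"
  and cis_add_factor: "cis x + cis z = 2 * of_real (cos ((x - z) / 2)) * cis ((x + z) / 2)"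
proof -
  have eq: "cis x = cis ((x - z) / 2) * cis ((x + z) / 2)" "cis z = cis (-((x - z) / 2)) * cis ((x + z) / 2)"
    by (simp_all add: cis_mult field_simps)
  moreover have eq2: "cis a - cis (-a) = 2 * \<i> * of_real (sin a)" "cis a + cis (-a) = 2 * of_real (cos a)" for a
    by (simp_all add: complex_eq_iff)
  ultimately show "cis x - cis z = 2 * \<i> * of_real (sin ((x - z) / 2)) * cis ((x + z) / 2)"
    by (metis left_diff_distrib)
  show "cis x + cis z = 2 * of_real (cos ((x - z) / 2)) * cis ((x + z) / 2)"
    using eq eq2 by (metis distrib_right)
qed

text \<open>With w = \<open>cis x\<close>, cot((x - z)/2) equals \<i> (w + cis z) / (w - cis z). As
  \<open>f z = 0\<close>, the polynomial of \<open>f\<close> has the factor w - cis z, which is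
  traded for \<i> (w + cis z) at no cost in degree. The identity is stated without a quotient so
  that it also makes sense at the pole.\<close>

lemma trig_mult_cot:
  assumes "f \<in> trig n" "f z = 0"
  obtains g where "g \<in> trig n" "\<And>x. g x * sin ((x - z) / 2) = f x * cos ((x - z) / 2)"
proof -
  obtain p where p: "degree p \<le> 2 * n" "\<And>x. of_real (f x) * cis x ^ n = poly p (cis x)"
    using assms by (metis trigE)
  have "poly p (cis z) = 0" using p(2)[of z] assms(2) by simp
  then obtain q where q: "p = [:- cis z, 1:] * q" by (metis dvdE poly_eq_0_iff_dvd)
  define r where "r = [:\<i> * cis z, \<i>:] * q"
  have degr: "degree r \<le> 2 * n"
  proof (cases "q = 0")
    case False
    have "degree r \<le> 1 + degree q"
      unfolding r_def by (rule order.trans[OF degree_mult_le]) simp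
    also have "\<dots> = degree p" unfolding q using False by (subst degree_mult_eq) auto
    finally show ?thesis using p(1) by simp
  qed (simp add: r_def)
  define G where "G x = poly r (cis x) * cis (-x) ^ n" for x
  have c1: "cis x ^ n * cis (-x) ^ n = 1" for x by (simp add: cis_mult flip: power_mult_distrib)
  have G: "G x * of_real (sin ((x - z) / 2)) = of_real (f x * cos ((x - z) / 2))" for x
  proof -
    have "poly r (cis x) * of_real (sin ((x - z) / 2)) = poly p (cis x) * of_real (cos ((x - z) / 2))"
    proof -
      have "poly r (cis x) = \<i> * (cis x + cis z) * poly q (cis x)"
        "poly p (cis x) = (cis x - cis z) * poly q (cis x)"
        by (simp_all add: r_def q algebra_simps)
      then show ?thesis
        by (simp only: cis_diff_factor cis_add_factor of_real_mult mult_ac)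
    qed
    then have "G x * of_real (sin ((x - z) / 2)) = poly p (cis x) * cis (-x) ^ n * of_real (cos ((x - z) / 2))"
      by (simp add: G_def mult_ac)
    also have "poly p (cis x) * cis (-x) ^ n = of_real (f x)"
      by (simp add: c1 mult.assoc flip: p(2))
    finally show ?thesis by simp
  qed
  show ?thesis
  proof (rule that)
    show "(\<lambda>x. Re (G x)) \<in> trig n"
      by (rule trig_Re[OF degr]) (simp add: G_def mult.assoc c1 mult.commute[of "cis (-x) ^ n" for x])
    show "Re (G x) * sin ((x - z) / 2) = f x * cos ((x - z) / 2)" for x
      using arg_cong[OF G, of Re x] by simp
  qed
qed

subsection \<open>Lagrange interpolation and sublevel sets\<close>

text \<open>Here \<open>k\<close> is the exact multiplicity of the root 1 of \<open>p\<close>.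
  Trading all factors w - 1 for \<i> (w + 1), and no more, leaves a polynomial that is nonzero at w
  = 1; hence \<open>g 0 \<noteq> 0\<close>, which is what makes a first-order gain at 0
  possible.\<close>

lemma trig_mult_cot_power:
  assumes "f \<in> trig n" "f x0 \<noteq> 0"
  obtains k g where "g \<in> trig n" "g 0 \<noteq> 0" "\<And>x. g x * sin (x / 2) ^ k = f x * cos (x / 2) ^ k"
proof -
  obtain p where p: "degree p \<le> 2 * n" "\<And>x. of_real (f x) * cis x ^ n = poly p (cis x)"
    using assms by (metis trigE)
  have "p \<noteq> 0" using p(2)[of x0] assms(2) by auto
  define k where "k = order 1 p"
  obtain q where q: "p = [:-1, 1:] ^ k * q" "\<not> [:-1, 1:] dvd q"
    using order_decomp[OF \<open>p \<noteq> 0\<close>, of 1] by (auto simp: k_def)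
  have "q \<noteq> 0" and q1: "poly q 1 \<noteq> 0" using q(2) by (auto simp: poly_eq_0_iff_dvd)
  define r where "r = [:\<i>, \<i>:] ^ k * q"
  have "degree r = degree p"
    using \<open>q \<noteq> 0\<close> by (simp add: r_def q(1) degree_mult_eq degree_power_eq)
  then have degr: "degree r \<le> 2 * n" using p(1) by simp
  define G where "G x = poly r (cis x) * cis (-x) ^ n" for x
  have c1: "cis x ^ n * cis (-x) ^ n = 1" for x by (simp add: cis_mult flip: power_mult_distrib)
  have G: "G x * of_real (sin (x / 2)) ^ k = of_real (f x * cos (x / 2) ^ k)" for x
  proof -
    have "poly r (cis x) * of_real (sin (x / 2)) ^ k = poly p (cis x) * of_real (cos (x / 2)) ^ k"
    proof -
      have "\<i> * (cis x + 1) * of_real (sin (x / 2)) = (cis x - 1) * of_real (cos (x / 2))"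
        using cis_add_factor[of x 0] cis_diff_factor[of x 0]
        by (simp only: cis_zero diff_zero mult_ac)
      then have "(\<i> * (cis x + 1)) ^ k * of_real (sin (x / 2)) ^ k = (cis x - 1) ^ k * of_real (cos (x / 2)) ^ k"
        by (simp only: flip: power_mult_distrib)
      then have "((\<i> * (cis x + 1)) ^ k * poly q (cis x)) * of_real (sin (x / 2)) ^ k
          = ((cis x - 1) ^ k * poly q (cis x)) * of_real (cos (x / 2)) ^ k"
        by (simp only: mult_ac)
      moreover have "poly r (cis x) = (\<i> * (cis x + 1)) ^ k * poly q (cis x)"
        "poly p (cis x) = (cis x - 1) ^ k * poly q (cis x)"
        by (simp_all add: r_def q(1) algebra_simps)
      ultimately show ?thesis by simp
    qed
    then have "G x * of_real (sin (x / 2)) ^ k = poly p (cis x) * cis (-x) ^ n * of_real (cos (x / 2)) ^ k"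
      by (simp add: G_def mult_ac)
    also have "poly p (cis x) * cis (-x) ^ n = of_real (f x)"
      by (simp add: c1 mult.assoc flip: p(2))
    finally show ?thesis by simp
  qed
  \<comment> \<open>For k > 0 the identity \<open>G\<close> reads 0 = 0 at x = 0 and says nothing
    about \<open>G 0\<close>. That \<open>G 0\<close> is real follows by continuity from points x >
    0, where the sine can be cancelled.\<close>
  have "continuous_on UNIV G"
    unfolding G_def cis_conv_exp by (intro continuous_intros)
  then have "isCont (\<lambda>x. Im (G x)) 0"
    by (auto simp: continuous_on_eq_continuous_at intro: continuous_intros)
  then have "((\<lambda>x. Im (G x)) \<longlongrightarrow> Im (G 0)) (at_right 0)"
    by (auto simp: continuous_at intro: tendsto_mono[OF at_le])
  moreover have "eventually (\<lambda>x. Im (G x) = 0) (at_right (0::real))"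
    unfolding eventually_at_right_field
  proof (intro exI[of _ "2::real"] conjI allI impI)
    fix y :: real assume y: "0 < y" "y < 2"
    then have "sin (y / 2) > 0" using pi_gt3 by (intro sin_gt_zero) auto
    then have "Im (G y) * sin (y / 2) ^ k = 0"
      using arg_cong[OF G[of y], of Im] by (simp flip: of_real_power)
    then show "Im (G y) = 0" using \<open>sin (y / 2) > 0\<close> by simp
  qed simp
  ultimately have "((\<lambda>x. 0) \<longlongrightarrow> Im (G 0)) (at_right (0::real))"
    by (rule Lim_transform_eventually)
  then have "Im (G 0) = 0" by (simp add: tendsto_const_iff)
  moreover have "G 0 \<noteq> 0"
    using q1 by (simp add: G_def r_def)
  ultimately have "Re (G 0) \<noteq> 0" by (simp add: complex_eq_iff)
  moreover have "(\<lambda>x. Re (G x)) \<in> trig n"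
    by (rule trig_Re[OF degr]) (simp add: G_def mult.assoc c1 mult.commute[of "cis (-x) ^ n" for x])
  moreover have "Re (G x) * sin (x / 2) ^ k = f x * cos (x / 2) ^ k" for x
    using arg_cong[OF G, of Re x] by (simp flip: of_real_power)
  ultimately show ?thesis using that by blast
qed

lemma sin_half_nonzero:
  assumes "x \<noteq> y" "\<bar>x - y\<bar> < 2 * pi"
  shows "sin ((x - y) / 2) \<noteq> (0::real)"
proof
  assume "sin ((x - y) / 2) = 0"
  then have "(x - y) / 2 = 0" using assms(2) sin_eq_0_pi[of "(x - y) / 2"] by auto
  then show False using assms(1) by simp
qed

section \<open>Trigonometric Lagrange interpolation and compactness\<close>

definition lagrange_basis :: "nat \<Rightarrow> (nat \<Rightarrow> real) \<Rightarrow> nat \<Rightarrow> real \<Rightarrow> real" where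
  "lagrange_basis n t i x = (\<Prod>j\<in>{..2*n} - {i}. sin ((x - t j) / 2) / sin ((t i - t j) / 2))"

lemma lagrange_basis_in_trig:
  assumes "i \<le> 2 * n"
  shows "lagrange_basis n t i \<in> trig n"
proof -
  have "(\<lambda>x. \<Prod>j\<in>{..2*n} - {i}. sin ((x - t j) / 2)) \<in> trig n"
    using assms by (intro prod_sin_in_trig) auto
  note trig_cmult[OF this, of "inverse (\<Prod>j\<in>{..2*n} - {i}. sin ((t i - t j) / 2))"]
  moreover have "lagrange_basis n t i = (\<lambda>x. inverse (\<Prod>j\<in>{..2*n} - {i}. sin ((t i - t j) / 2)) *
      (\<Prod>j\<in>{..2*n} - {i}. sin ((x - t j) / 2)))"
    unfolding lagrange_basis_def prod_dividef by (rule ext) (rule divide_inverse_commute)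
  ultimately show ?thesis by simp
qed

lemma lagrange_basis_node:
  assumes "inj_on t {..2*n}" "t ` {..2*n} \<subseteq> {0..<2*pi}" "i \<le> 2 * n" "k \<le> 2 * n"
  shows "lagrange_basis n t i (t k) = (if k = i then 1 else 0)"
proof (cases "k = i")
  case True
  have "sin ((t i - t j) / 2) \<noteq> 0" if "j \<in> {..2*n} - {i}" for j
  proof (rule sin_half_nonzero)
    show "t i \<noteq> t j" using that assms by (auto simp: inj_on_def)
    have "t i \<in> {0..<2*pi}" "t j \<in> {0..<2*pi}" using that assms by auto
    then show "\<bar>t i - t j\<bar> < 2 * pi" by auto
  qed
  then show ?thesis using True by (simp add: lagrange_basis_def)
next
  case False
  then have "k \<in> {..2*n} - {i}" using assms by simp
  then show ?thesis using False by (auto simp: lagrange_basis_def intro!: prod_zero bexI[of _ k])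
qed

lemma lagrange_interpolation:
  assumes f: "f \<in> trig n" and t: "inj_on t {..2*n}" "t ` {..2*n} \<subseteq> {0..<2*pi}"
  shows "f x = (\<Sum>i\<le>2*n. f (t i) * lagrange_basis n t i x)"
proof (rule trig_cong_points[OF f _ _ t(2)])
  show "(\<lambda>x. \<Sum>i\<le>2*n. f (t i) * lagrange_basis n t i x) \<in> trig n"
    by (intro trig_sum trig_cmult lagrange_basis_in_trig) auto
  show "2 * n < card (t ` {..2*n})" using t by (simp add: card_image)
  fix y assume "y \<in> t ` {..2*n}"
  then obtain k where k: "k \<le> 2 * n" "y = t k" by auto
  have "(\<Sum>i\<le>2*n. f (t i) * lagrange_basis n t i y) = (\<Sum>i\<le>2*n. if k = i then f (t i) else 0)"
    by (rule sum.cong) (use k t in \<open>auto simp: lagrange_basis_node\<close>)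
  also have "\<dots> = f y" using k by simp
  finally show "f y = (\<Sum>i\<le>2*n. f (t i) * lagrange_basis n t i y)" ..
qed auto

text \<open>Interpolation reduces pointwise convergence everywhere to convergence at 2n + 1 nodes,
  where boundedness yields a subsequence. The limit is the interpolant of the limit values and so
  has degree n again.\<close>

lemma trig_convergent_subsequence:
  assumes f: "\<And>m. f m \<in> trig n" and b: "\<And>m x. \<bar>f m x\<bar> \<le> B"
  obtains r g where "strict_mono (r :: nat \<Rightarrow> nat)" "g \<in> trig n" "\<And>x. (\<lambda>m. f (r m) x) \<longlonglongrightarrow> g x"
proof -
  define t where "t i = 2 * pi * (real i / (2 * n + 1))" for i
  have "t i < 2 * pi * 1" if "i \<le> 2 * n" for i
    unfolding t_def by (rule mult_strict_left_mono) (use that in auto)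
  then have t: "inj_on t {..2*n}" "t ` {..2*n} \<subseteq> {0..<2*pi}"
    by (auto simp: inj_on_def t_def)
  obtain r where r: "strict_mono (r :: nat \<Rightarrow> nat)"
    "\<And>i. i \<in> {..2*n} \<Longrightarrow> \<exists>l. (\<lambda>m. f (r m) (t i)) \<longlonglongrightarrow> l"
    using function_convergent_subsequence[of "{..2*n}" "\<lambda>m i. f m (t i)" B] b by auto
  from r(2) obtain l where l: "\<And>i. i \<in> {..2*n} \<Longrightarrow> (\<lambda>m. f (r m) (t i)) \<longlonglongrightarrow> l i"
    by metis
  show ?thesis
  proof (rule that[OF r(1)])
    show "(\<lambda>x. \<Sum>i\<le>2*n. l i * lagrange_basis n t i x) \<in> trig n"
      by (intro trig_sum trig_cmult lagrange_basis_in_trig) auto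
    show "(\<lambda>m. f (r m) x) \<longlonglongrightarrow> (\<Sum>i\<le>2*n. l i * lagrange_basis n t i x)" for x
      unfolding lagrange_interpolation[OF f t, of _ x]
      by (intro tendsto_intros l) auto
  qed
qed

section \<open>Measures of sublevel sets\<close>

text \<open>The range type is general so that complex \<open>Q\<close> and its real part share the
  lemmas. The level is a parameter because the existence of an extremal polynomial is proved by
  minimising it.\<close>

definition sublevel :: "(real \<Rightarrow> 'a::real_normed_vector) \<Rightarrow> real \<Rightarrow> real set" where
  "sublevel f l = {x \<in> {0..<2*pi}. norm (f x) \<le> l}"

lemma sublevel_lmeasurable:
  assumes "continuous_on UNIV f"
  shows "sublevel f l \<in> lmeasurable"
proof -
  have "closed {x. norm (f x) \<le> l}"
    by (intro closed_Collect_le continuous_intros assms)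
  moreover have "sublevel f l = {0..<2*pi} \<inter> {x. norm (f x) \<le> l}"
    by (auto simp: sublevel_def)
  ultimately have "sublevel f l \<in> sets borel" by auto
  then have "sublevel f l \<in> sets lebesgue" by auto
  moreover have "bounded (sublevel f l)"
    by (rule bounded_subset[OF bounded_closed_interval[of 0 "2*pi"]]) (auto simp: sublevel_def)
  ultimately show ?thesis using bounded_set_imp_lmeasurable by blast
qed

lemma measure_sublevel_mono:
  assumes "continuous_on UNIV f" "continuous_on UNIV g" "\<And>x. norm (f x) \<le> l \<Longrightarrow> norm (g x) \<le> m"
  shows "measure lebesgue (sublevel f l) \<le> measure lebesgue (sublevel g m)"
  by (intro measure_mono_fmeasurable sublevel_lmeasurable assms fmeasurableD)
    (use assms(3) in \<open>auto simp: sublevel_def\<close>)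

text \<open>The translated window [a, 2 pi + a) is cut at 2 pi, and the piece beyond is moved back
  by one period.\<close>

lemma measure_sublevel_shift_less:
  fixes f :: "real \<Rightarrow> 'a::real_normed_vector"
  assumes cont: "continuous_on UNIV f" and per: "\<And>x. f (x + 2 * pi) = f x" and a: "a \<in> {0..<2*pi}"
  shows "measure lebesgue (sublevel (\<lambda>x. f (x + a)) l) = measure lebesgue (sublevel f l)"
proof -
  define B where "B = {x. norm (f x) \<le> l}"
  have "closed B"
    unfolding B_def by (intro closed_Collect_le continuous_intros cont)
  then have m: "{u..<v} \<inter> B \<in> lmeasurable" for u v :: real
    by (intro bounded_set_imp_lmeasurable) (auto intro: bounded_subset[OF bounded_closed_interval[of u v]])
  have tr: "measure lebesgue ({u + c..<v + c} \<inter> B) = measure lebesgue ({u..<v} \<inter> {x. x + c \<in> B})" for u v c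
  proof -
    have "{u + c..<v + c} \<inter> B = (+) c ` ({u..<v} \<inter> {x. x + c \<in> B})"
    proof (intro equalityI subsetI)
      fix x assume "x \<in> {u + c..<v + c} \<inter> B"
      then have "x - c \<in> {u..<v} \<inter> {x. x + c \<in> B}" by auto
      then show "x \<in> (+) c ` ({u..<v} \<inter> {x. x + c \<in> B})" by (rule rev_image_eqI) simp
    qed (auto simp: add.commute)
    then show ?thesis by (simp only: measure_translation)
  qed
  have un: "measure lebesgue ({u..<v} \<inter> B) + measure lebesgue ({v..<w} \<inter> B) = measure lebesgue ({u..<w} \<inter> B)"
    if "u \<le> v" "v \<le> w" for u v w
  proof -
    have eq: "{u..<w} \<inter> B = ({u..<v} \<inter> B) \<union> ({v..<w} \<inter> B)" using that by auto
    have "({u..<v} \<inter> B) \<inter> ({v..<w} \<inter> B) = {}" by auto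
    then show ?thesis unfolding eq using m by (subst measure_Un3) auto
  qed
  have "sublevel (\<lambda>x. f (x + a)) l = {0..<2*pi} \<inter> {x. x + a \<in> B}"
    by (auto simp: sublevel_def B_def)
  then have "measure lebesgue (sublevel (\<lambda>x. f (x + a)) l) = measure lebesgue ({a..<2*pi+a} \<inter> B)"
    using tr[of 0 a "2*pi"] by simp
  also have "\<dots> = measure lebesgue ({a..<2*pi} \<inter> B) + measure lebesgue ({2*pi..<2*pi+a} \<inter> B)"
    using a by (subst un) auto
  also have "measure lebesgue ({2*pi..<2*pi+a} \<inter> B) = measure lebesgue ({0..<a} \<inter> B)"
    using tr[of 0 "2*pi" a] by (simp add: B_def per add.commute)
  also have "measure lebesgue ({a..<2*pi} \<inter> B) + measure lebesgue ({0..<a} \<inter> B) = measure lebesgue ({0..<2*pi} \<inter> B)"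
    using a un[of 0 a "2*pi"] by auto
  also have "{0..<2*pi} \<inter> B = sublevel f l" by (auto simp: sublevel_def B_def)
  finally show ?thesis .
qed

lemma measure_sublevel_shift:
  fixes f :: "real \<Rightarrow> 'a::real_normed_vector"
  assumes cont: "continuous_on UNIV f" and per: "\<And>x. f (x + 2 * pi) = f x"
  shows "measure lebesgue (sublevel (\<lambda>x. f (x + a)) l) = measure lebesgue (sublevel f l)"
proof -
  obtain y and k :: int where y: "y \<in> {0..<0 + 2 * pi}" "a = y + 2 * pi * k"
    by (rule periodic_representative) blast
  have "f (x + a) = f (x + y)" for x
    unfolding y(2) using periodic_int[of f "x + y" k] per by (simp add: add.assoc)
  then show ?thesis using measure_sublevel_shift_less[OF cont per, of y l] y(1) by simp
qed

text \<open>A point that lies in infinitely many of the sublevel sets lies in that of the limit. The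
  set of these points is the decreasing intersection of the tails \<open>A N\<close>, which have
  finite measure at least \<open>L\<close>, so continuity from above applies.\<close>

lemma measure_sublevel_limit:
  fixes f :: "nat \<Rightarrow> real \<Rightarrow> 'a::real_normed_vector"
  assumes cont: "\<And>m. continuous_on UNIV (f m)" "continuous_on UNIV g"
    and lim: "\<And>x. (\<lambda>m. f m x) \<longlonglongrightarrow> g x" "l \<longlonglongrightarrow> l'"
    and L: "\<And>m. L \<le> measure lebesgue (sublevel (f m) (l m))"
  shows "L \<le> measure lebesgue (sublevel g l')"
proof -
  define A where "A N = (\<Union>m\<in>{N..}. sublevel (f m) (l m))" for N :: nat
  have m: "sublevel (f m) (l m) \<in> sets lebesgue" for m
    using sublevel_lmeasurable[OF cont(1)] by (auto dest: fmeasurableD)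
  then have As: "A N \<in> sets lebesgue" for N
    unfolding A_def by (intro sets.countable_UN') auto
  have Ab: "A N \<subseteq> {0..2*pi}" for N by (auto simp: A_def sublevel_def)
  have Am: "A N \<in> lmeasurable" for N
    using As Ab by (meson bounded_closed_interval bounded_set_imp_lmeasurable bounded_subset)
  have "decseq A" unfolding A_def decseq_def by fastforce
  have "(\<lambda>N. measure lebesgue (A N)) \<longlonglongrightarrow> measure lebesgue (\<Inter>N. A N)"
  proof (rule Lim_measure_decseq)
    show "emeasure lebesgue (A N) \<noteq> \<infinity>" for N using fmeasurableD2[OF Am] by simp
  qed (use As \<open>decseq A\<close> in auto)
  moreover have "L \<le> measure lebesgue (A N)" for N
  proof -
    have "sublevel (f N) (l N) \<subseteq> A N" by (auto simp: A_def)
    then show ?thesis using L[of N] measure_mono_fmeasurable[OF _ m Am] by (meson order.trans)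
  qed
  ultimately have "L \<le> measure lebesgue (\<Inter>N. A N)"
    by (meson LIMSEQ_le_const)
  also have "\<dots> \<le> measure lebesgue (sublevel g l')"
  proof (rule measure_mono_fmeasurable)
    show "(\<Inter>N. A N) \<in> sets lebesgue" using As by auto
    show "sublevel g l' \<in> lmeasurable" by (rule sublevel_lmeasurable[OF cont(2)])
    show "(\<Inter>N. A N) \<subseteq> sublevel g l'"
    proof
      fix x assume x: "x \<in> (\<Inter>N. A N)"
      then have x0: "x \<in> {0..<2*pi}" by (auto simp: A_def sublevel_def)
      have "\<exists>m\<ge>N. norm (f m x) \<le> l m" for N
        using x by (auto simp: A_def sublevel_def)
      then have fr: "\<exists>\<^sub>F m in sequentially. norm (f m x) \<le> l m"
        by (auto simp: frequently_sequentially)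
      have "norm (g x) \<le> l'"
      proof (rule ccontr)
        assume "\<not> norm (g x) \<le> l'"
        then have "norm (g x) - l' > 0" by simp
        moreover have "(\<lambda>m. norm (f m x) - l m) \<longlonglongrightarrow> norm (g x) - l'"
          by (intro tendsto_intros lim)
        ultimately have "\<forall>\<^sub>F m in sequentially. norm (f m x) - l m > 0"
          by (rule order_tendstoD(1)[rotated])
        with fr show False
          by (metis (mono_tags, lifting) diff_gt_0_iff_gt eventually_mono frequently_def not_less)
      qed
      then show "x \<in> sublevel g l'" using x0 by (simp add: sublevel_def)
    qed
  qed
  finally show ?thesis .
qed

section \<open>Existence of an extremal polynomial\<close>

lemma trig_attains_max:
  assumes "f \<in> trig n"
  obtains a where "a \<in> {0..<2*pi}" "\<And>x. \<bar>f x\<bar> \<le> \<bar>f a\<bar>"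
proof -
  have "continuous_on {0..2*pi} (\<lambda>x. \<bar>f x\<bar>)"
    by (intro continuous_intros trig_continuous[OF assms])
  then obtain b where b: "b \<in> {0..2*pi}" "\<And>x. x \<in> {0..2*pi} \<Longrightarrow> \<bar>f x\<bar> \<le> \<bar>f b\<bar>"
    using continuous_attains_sup[of "{0..2*pi}" "\<lambda>x. \<bar>f x\<bar>"] by auto
  have red: "\<exists>y\<in>{0..<2*pi}. f x = f y" for x
  proof -
    obtain y and k :: int where y: "y \<in> {0..<0 + 2 * pi}" "x = y + 2 * pi * k"
      by (rule periodic_representative) blast
    have "f x = f y" unfolding y(2) by (rule periodic_int) (rule trig_periodic[OF assms])
    then show ?thesis using y by auto
  qed
  obtain a where a: "a \<in> {0..<2*pi}" "f b = f a" using red[of b] by blast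
  have "\<bar>f x\<bar> \<le> \<bar>f a\<bar>" for x
    using red[of x] b(2) a by force
  then show ?thesis using a that by blast
qed

text \<open>Translation and sign change preserve the class of competitors, so the norm of
  \<open>P\<close> may be placed at 0 with positive sign; \<open>P 0\<close> is then the extremal
  norm.\<close>

definition remez_extremal :: "nat \<Rightarrow> real \<Rightarrow> (real \<Rightarrow> real) \<Rightarrow> bool" where
  "remez_extremal n L P \<longleftrightarrow> P \<in> trig n \<and> (\<forall>x. \<bar>P x\<bar> \<le> P 0) \<and> L \<le> measure lebesgue (sublevel P 1) \<and>
     (\<forall>f\<in>trig n. L \<le> measure lebesgue (sublevel f 1) \<longrightarrow> (\<forall>x. \<bar>f x\<bar> \<le> P 0))"

text \<open>No bound on the competitors is known yet, so compactness is applied to the dual problem: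
  the norm is fixed as f 0 = 1, and the level \<open>l\<close> whose sublevel set still has measure
  \<open>L\<close> is minimised. Division by the least level \<open>l0\<close> turns the minimiser
  into an extremal polynomial. The condition \<open>L \<le> 2 * pi\<close> makes the constant 1
  feasible; \<open>0 < L\<close> excludes \<open>l0 = 0\<close>.\<close>

lemma remez_extremal_exists:
  assumes L: "0 < L" "L \<le> 2 * pi"
  obtains P where "remez_extremal n L P"
proof -
  define ok where "ok f l \<longleftrightarrow> f \<in> trig n \<and> f 0 = 1 \<and> (\<forall>x. \<bar>f x\<bar> \<le> 1) \<and> 0 \<le> l \<and>
    L \<le> measure lebesgue (sublevel f l)" for f l
  define K where "K = {l. \<exists>f. ok f l}"
  define l0 where "l0 = Inf K"
  have "sublevel (\<lambda>x. 1::real) 1 = {0..<2*pi}" by (auto simp: sublevel_def)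
  then have "ok (\<lambda>x. 1) 1" using L by (simp add: ok_def trig_const)
  then have "K \<noteq> {}" by (auto simp: K_def)
  have bdd: "bdd_below K" by (rule bdd_belowI[of _ 0]) (auto simp: K_def ok_def)
  have "l0 \<in> closure K" unfolding l0_def by (rule closure_contains_Inf) fact+
  then obtain l where l: "\<And>m. l m \<in> K" "l \<longlonglongrightarrow> l0" by (auto simp: closure_sequential)
  have "\<forall>m. \<exists>h. ok h (l m)" using l(1) by (simp add: K_def)
  then obtain f where f: "\<And>m. ok (f m) (l m)" by metis
  have ft: "f m \<in> trig n" "\<bar>f m x\<bar> \<le> 1" for m x using f[of m] by (auto simp: ok_def)
  obtain r g where r: "strict_mono (r :: nat \<Rightarrow> nat)" "g \<in> trig n" "\<And>x. (\<lambda>m. f (r m) x) \<longlonglongrightarrow> g x"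
    by (rule trig_convergent_subsequence[of f n 1, OF ft]) blast
  have lr: "(\<lambda>m. l (r m)) \<longlonglongrightarrow> l0"
    using LIMSEQ_subseq_LIMSEQ[OF l(2) r(1)] by (simp add: o_def)
  have g0: "g 0 = 1"
  proof -
    have "f (r m) 0 = 1" for m using f by (simp add: ok_def)
    then show ?thesis using r(3)[of 0] by (simp add: LIMSEQ_const_iff)
  qed
  have g1: "\<bar>g x\<bar> \<le> 1" for x
    by (rule LIMSEQ_le_const2[OF tendsto_rabs[OF r(3)[of x]]]) (intro exI allI impI ft(2))
  have gL: "L \<le> measure lebesgue (sublevel g l0)"
  proof (rule measure_sublevel_limit[where f = "\<lambda>m. f (r m)" and l = "\<lambda>m. l (r m)"])
    show "continuous_on UNIV (f (r m))" for m by (rule trig_continuous[OF ft(1)])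
    show "continuous_on UNIV g" by (rule trig_continuous[OF r(2)])
    show "L \<le> measure lebesgue (sublevel (f (r m)) (l (r m)))" for m
      using f[of "r m"] by (simp add: ok_def)
  qed (fact r(3) lr)+
  have l0: "0 \<le> l0" by (rule LIMSEQ_le_const[OF l(2)]) (use f in \<open>simp add: ok_def\<close>)
  \<comment> \<open>At level 0 the limit \<open>g\<close> would vanish on a set of positive measure,
    hence at more than 2n points, against \<open>g 0 = 1\<close>.\<close>
  have "l0 \<noteq> 0"
  proof
    assume "l0 = 0"
    then have z: "g x = 0" if "x \<in> sublevel g l0" for x using that by (auto simp: sublevel_def)
    have "infinite (sublevel g l0)"
    proof
      assume "finite (sublevel g l0)"
      then have "measure lebesgue (sublevel g l0) = 0"
        by (simp add: negligible_imp_measure0 negligible_finite)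
      then show False using gL L by simp
    qed
    then obtain S where S: "S \<subseteq> sublevel g l0" "finite S" "card S = 2 * n + 1"
      using infinite_arbitrarily_large[of "sublevel g l0" "2 * n + 1"] by blast
    have "g 0 = 0"
    proof (rule trig_eq_0[OF r(2) S(2)])
      show "S \<subseteq> {0..<2*pi}" using S(1) by (auto simp: sublevel_def)
      show "2 * n < card S" using S(3) by simp
    qed (use S(1) z in blast)
    then show False using g0 by simp
  qed
  then have l0p: "l0 > 0" using l0 by simp
  define P where "P x = (1 / l0) * g x" for x
  have P: "P \<in> trig n" unfolding P_def[abs_def] by (rule trig_cmult[OF r(2)])
  have "remez_extremal n L P"
    unfolding remez_extremal_def
  proof (intro conjI allI ballI impI P)
    show "\<bar>P x\<bar> \<le> P 0" for x using g1[of x] g0 l0p by (simp add: P_def abs_mult divide_simps)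
    have "sublevel P 1 = sublevel g l0"
      using l0p by (auto simp: sublevel_def P_def abs_mult field_simps)
    then show "L \<le> measure lebesgue (sublevel P 1)" using gL by simp
    fix h x assume h: "h \<in> trig n" "L \<le> measure lebesgue (sublevel h 1)"
    obtain a where a: "\<And>x. \<bar>h x\<bar> \<le> \<bar>h a\<bar>" by (rule trig_attains_max[OF h(1)]) blast
    show "\<bar>h x\<bar> \<le> P 0"
    proof (cases "h a = 0")
      case True
      then show ?thesis using a[of x] g0 l0p by (simp add: P_def)
    next
      case False
      \<comment> \<open>Moving the maximum point to 0 and dividing by the signed value
        \<open>h a\<close> makes the competitor feasible for the dual problem at level 1/|h
        a|.\<close>
      define h' where "h' x = (1 / h a) * h (x + a)" for x
      have "h' \<in> trig n" unfolding h'_def[abs_def] by (intro trig_cmult trig_shift h)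
      moreover have "L \<le> measure lebesgue (sublevel h' (1 / \<bar>h a\<bar>))"
      proof -
        have "sublevel h' (1 / \<bar>h a\<bar>) = sublevel (\<lambda>x. h (x + a)) 1"
          using False by (auto simp: sublevel_def h'_def abs_mult divide_simps)
        then show ?thesis
          using measure_sublevel_shift[OF trig_continuous[OF h(1)] trig_periodic[OF h(1)], of a 1] h(2) by simp
      qed
      ultimately have "ok h' (1 / \<bar>h a\<bar>)"
        unfolding ok_def
      proof (intro conjI allI)
        show "\<bar>h' x\<bar> \<le> 1" for x
          using a[of "x + a"] False by (simp add: h'_def abs_mult divide_simps)
      qed (use False in \<open>simp_all add: h'_def\<close>)
      then have "l0 \<le> 1 / \<bar>h a\<bar>" unfolding l0_def by (intro cInf_lower bdd) (auto simp: K_def)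
      then have "\<bar>h a\<bar> \<le> 1 / l0" using False l0p by (simp add: field_simps)
      then show ?thesis using a[of x] g0 by (simp add: P_def)
    qed
  qed
  then show ?thesis using that by blast
qed

subsection \<open>Pushing the sublevel set away from a critical point\<close>

text \<open>By change of variables the measure of the image is the integral of |g'| over
  \<open>E\<close>, and the integrand is at least 1.\<close>

lemma measure_le_expanding_image:
  fixes g :: "real \<Rightarrow> real"
  assumes E: "compact E" and der: "\<And>x. x \<in> E \<Longrightarrow> (g has_real_derivative g' x) (at x)"
    and g': "\<And>x. x \<in> E \<Longrightarrow> 1 \<le> g' x" and inj: "inj_on g E"
  shows "measure lebesgue E \<le> measure lebesgue (g ` E)"
proof -
  have "continuous_on E g"
    by (meson DERIV_isCont continuous_at_imp_continuous_on der)
  then have gE: "g ` E \<in> lmeasurable"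
    by (intro lmeasurable_compact compact_continuous_image E)
  have El: "E \<in> lmeasurable" by (rule lmeasurable_compact[OF E])
  have "(\<lambda>x. 1::real) absolutely_integrable_on (g ` E) \<and> integral (g ` E) (\<lambda>x. 1::real) = measure lebesgue (g ` E)"
    using absolutely_integrable_on_const[OF gE, of 1] lmeasure_integral[OF gE] by simp
  then have "(\<lambda>x. \<bar>g' x\<bar> * 1) absolutely_integrable_on E \<and> integral E (\<lambda>x. \<bar>g' x\<bar> * 1) = measure lebesgue (g ` E)"
    using has_absolute_integral_change_of_variables_1'[of E g g' "\<lambda>x. 1" "measure lebesgue (g ` E)",
        OF fmeasurableD[OF El] has_field_derivative_at_within[OF der] inj] by blast
  then have int: "(\<lambda>x. \<bar>g' x\<bar>) integrable_on E" "integral E (\<lambda>x. \<bar>g' x\<bar>) = measure lebesgue (g ` E)"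
    by (auto intro: set_lebesgue_integral_eq_integral(1))
  have "measure lebesgue E = integral E (\<lambda>x. 1)" using El by (rule lmeasure_integral)
  also have "\<dots> \<le> integral E (\<lambda>x. \<bar>g' x\<bar>)"
    by (rule integral_le[OF integrable_on_const[OF El] int(1)]) (use g' in force)
  finally show ?thesis using int(2) by simp
qed

lemma trig_lipschitz:
  assumes "f \<in> trig n"
  obtains B where "B > 0" "\<And>x y. \<bar>f x - f y\<bar> \<le> B * \<bar>x - y\<bar>"
proof -
  obtain f' where f': "f' \<in> trig n" "\<And>x. (f has_real_derivative f' x) (at x)"
    by (rule trig_derivative[OF assms]) blast
  obtain B where B: "B > 0" "\<And>x. \<bar>f' x\<bar> \<le> B"
    by (rule trig_bounded[OF f'(1)]) blast
  have "\<bar>f x - f y\<bar> \<le> B * \<bar>x - y\<bar>" for x y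
  proof -
    have "norm (f x - f y) \<le> B * norm (x - y)"
      by (rule field_differentiable_bound[of UNIV f f'])
        (use B(2) in \<open>simp_all add: f'(2)\<close>)
    then show ?thesis by simp
  qed
  then show ?thesis using B(1) that by blast
qed

text \<open>The constant is uniform in \<open>x\<close>, so a single rescaling can absorb the
  second-order errors at all displaced points. It is a Lipschitz constant of
  \<open>f'\<close>.\<close>

lemma trig_taylor:
  assumes "f \<in> trig n" "f' \<in> trig n" "\<And>x. (f has_real_derivative f' x) (at x)"
  obtains B where "B > 0" "\<And>x h. \<bar>f (x + h) - f x - f' x * h\<bar> \<le> B * h\<^sup>2"
proof -
  obtain B where B: "B > 0" "\<And>x y. \<bar>f' x - f' y\<bar> \<le> B * \<bar>x - y\<bar>"
    by (rule trig_lipschitz[OF assms(2)]) blast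
  have "\<bar>f (x + h) - f x - f' x * h\<bar> \<le> B * h\<^sup>2" for x h
  proof -
    define F where "F y = f y - f' x * y" for y
    have "\<bar>F (x + h) - F x\<bar> \<le> B * \<bar>h\<bar> * \<bar>x + h - x\<bar>"
    proof -
      have "norm (F (x + h) - F x) \<le> B * \<bar>h\<bar> * norm (x + h - x)"
      proof (rule field_differentiable_bound[of "cball x \<bar>h\<bar>" F "\<lambda>y. f' y - f' x"])
        show "(F has_field_derivative f' y - f' x) (at y within cball x \<bar>h\<bar>)" for y
          unfolding F_def by (rule has_field_derivative_at_within) (auto intro!: derivative_eq_intros assms)
        show "norm (f' y - f' x) \<le> B * \<bar>h\<bar>" if "y \<in> cball x \<bar>h\<bar>" for y
        proof -
          have "\<bar>y - x\<bar> \<le> \<bar>h\<bar>" using that by (simp add: dist_real_def abs_minus_commute)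
          then have "B * \<bar>y - x\<bar> \<le> B * \<bar>h\<bar>" using B(1) by simp
          then show ?thesis using B(2)[of y x] by simp
        qed
      qed (auto simp: dist_real_def)
      then show ?thesis by simp
    qed
    moreover have "F (x + h) - F x = f (x + h) - f x - f' x * h" by (simp add: F_def algebra_simps)
    moreover have "B * \<bar>h\<bar> * \<bar>x + h - x\<bar> = B * h\<^sup>2" by (simp add: power2_eq_square)
    ultimately show ?thesis by metis
  qed
  then show ?thesis using B(1) that by blast
qed

lemma cot_power_bound:
  fixes D :: "real set"
  assumes D: "compact D" "\<And>x. x \<in> D \<Longrightarrow> sin (x / 2) \<noteq> 0"
  obtains w B where "B > 0" "\<And>x. x \<in> D \<Longrightarrow> ((\<lambda>x. cot (x / 2) ^ k) has_real_derivative w x) (at x)"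
    "\<And>x. x \<in> D \<Longrightarrow> \<bar>w x\<bar> \<le> B"
proof -
  define w where "w x = real k * cot (x / 2) ^ (k - 1) * (- inverse ((sin (x / 2))\<^sup>2) * (1 / 2))" for x
  have "((\<lambda>x. cot (x / 2) ^ k) has_real_derivative w x) (at x)" if "x \<in> D" for x
    unfolding w_def using D(2)[OF that]
    by (auto intro!: derivative_eq_intros DERIV_chain2[OF DERIV_cot])
  moreover have "continuous_on D w"
    unfolding w_def cot_def by (intro continuous_intros) (use D(2) in auto)
  then have "bounded (w ` D)"
    by (intro compact_imp_bounded compact_continuous_image D)
  then obtain B where "B > 0" "\<And>y. y \<in> w ` D \<Longrightarrow> norm y \<le> B"
    using bounded_pos by metis
  ultimately show ?thesis using that[of B w] by auto
qed

lemma trig_improve: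
  assumes P: "P \<in> trig n" and P': "P' \<in> trig n" and der: "\<And>x. (P has_real_derivative P' x) (at x)"
    and max: "\<And>x. \<bar>P x\<bar> \<le> P 0" and P0: "1 < P 0" and x0: "\<bar>P x0\<bar> \<le> 1"
    and z: "0 < z" "z < 2 * pi" "P' z = 0" "1 < \<bar>P z\<bar>"
  obtains Q where "Q \<in> trig n" "P 0 < Q 0"
    "measure lebesgue (sublevel P 1) \<le> measure lebesgue (sublevel Q 1)"
proof -
  have P'0: "P' 0 = 0"
    by (rule DERIV_local_max[OF der, of 1]) (use max in \<open>auto intro: order.trans[OF abs_ge_self]\<close>)
  have "\<exists>y. P' y \<noteq> 0"
  proof (rule ccontr)
    assume "\<not> (\<exists>y. P' y \<noteq> 0)"
    then have "\<forall>x. DERIV P x :> 0" using der by (metis (full_types))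
    then have "P x0 = P 0" by (rule DERIV_isconst_all)
    then show False using x0 P0 by simp
  qed
  then obtain y0 where "P' y0 \<noteq> 0" by blast
  obtain k S where S: "S \<in> trig n" "S 0 \<noteq> 0" "\<And>x. S x * sin (x / 2) ^ k = P' x * cos (x / 2) ^ k"
    by (rule trig_mult_cot_power[OF P' \<open>P' y0 \<noteq> 0\<close>]) blast
  obtain T where T: "T \<in> trig n" "\<And>x. T x * sin ((x - z) / 2) = P' x * cos ((x - z) / 2)"
    by (rule trig_mult_cot[OF P' z(3)]) blast
  \<comment> \<open>The field with pole at \<open>z\<close> leaves the value at 0 unchanged, so the
    gain there comes from \<open>\<eta> * S 0\<close> alone.\<close>
  have T0: "T 0 = 0"
    using T(2)[of 0] P'0 sin_half_nonzero[of 0 z] z by simp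
  define E where "E = sublevel P 1"
  have per: "P (2 * pi) = P 0" using trig_periodic[OF P, of 0] by simp
  \<comment> \<open>The closed interval adds no point, as P(2 pi) = \<open>P 0\<close> > 1. This
    makes \<open>E\<close> compact, hence at positive distance from the poles 0, \<open>z\<close>
    and 2 pi.\<close>
  have E: "E = {0..2*pi} \<inter> {x. \<bar>P x\<bar> \<le> 1}"
    using P0 per by (auto simp: E_def sublevel_def order_le_less)
  have "closed {x. \<bar>P x\<bar> \<le> 1}"
    by (intro closed_Collect_le continuous_intros trig_continuous[OF P])
  then have cE: "compact E" unfolding E by (intro compact_Int_closed compact_Icc)
  have notE: "0 \<notin> E" "z \<notin> E" "2 * pi \<notin> E" using P0 per z by (auto simp: E)
  have "\<exists>d>0. \<forall>x\<in>E. d \<le> dist a x" if "a \<notin> E" for a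
    using separate_point_closed[OF compact_imp_closed[OF cE] that] .
  then obtain d1 d2 d3 where d: "d1 > 0" "d2 > 0" "d3 > 0" "\<And>x. x \<in> E \<Longrightarrow> d1 \<le> dist 0 x"
    "\<And>x. x \<in> E \<Longrightarrow> d2 \<le> dist z x" "\<And>x. x \<in> E \<Longrightarrow> d3 \<le> dist (2*pi) x"
    using notE by metis
  define \<delta> where "\<delta> = min d1 (min d2 d3)"
  have \<delta>: "\<delta> > 0" using d by (simp add: \<delta>_def)
  define J1 where "J1 = {\<delta>..z - \<delta>}"
  define J2 where "J2 = {z + \<delta>..2 * pi - \<delta>}"
  define D where "D = J1 \<union> J2"
  have ED: "E \<subseteq> D"
  proof
    fix x assume x: "x \<in> E"
    then have "0 \<le> x" "x \<le> 2 * pi" by (auto simp: E)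
    then show "x \<in> D"
      using d(4-6)[OF x] by (auto simp: D_def J1_def J2_def \<delta>_def dist_real_def min_def abs_if split: if_splits)
  qed
  have D: "0 < x" "x < 2 * pi" "x \<noteq> z" if "x \<in> D" for x
    using that \<delta> z by (auto simp: D_def J1_def J2_def)
  have cD: "compact D" by (auto simp: D_def J1_def J2_def)
  have s1: "sin (x / 2) \<noteq> 0" if "x \<in> D" for x
    using sin_half_nonzero[of x 0] D[OF that] by simp
  have s2: "sin ((x - z) / 2) \<noteq> 0" if "x \<in> D" for x
    by (rule sin_half_nonzero) (use D[OF that] z in auto)
  obtain w B where w: "B > 0" "\<And>x. x \<in> D \<Longrightarrow> ((\<lambda>x. cot (x / 2) ^ k) has_real_derivative w x) (at x)"
    "\<And>x. x \<in> D \<Longrightarrow> \<bar>w x\<bar> \<le> B"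
    by (rule cot_power_bound[OF cD s1, of k]) blast+
  \<comment> \<open>The sign makes the gain \<open>\<eta> * S 0\<close> positive. The size keeps
    |\<eta> w| at most 1/2, which is the lower bound for the derivative of - cot((x - z)/2).\<close>
  define \<eta> where "\<eta> = sgn (S 0) / (2 * B)"
  have \<eta>S: "\<eta> * S 0 > 0"
    using S(2) w(1) by (simp add: \<eta>_def sgn_if)
  have \<eta>w: "\<eta> * w x \<le> 1 / 2" if "x \<in> D" for x
  proof -
    have "\<eta> * w x \<le> \<bar>\<eta>\<bar> * \<bar>w x\<bar>" by (metis abs_ge_self abs_mult)
    also have "\<dots> \<le> \<bar>\<eta>\<bar> * B" using w(3)[OF that] by (intro mult_left_mono) auto
    also have "\<dots> = 1 / 2" using S(2) w(1) by (simp add: \<eta>_def sgn_if)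
    finally show ?thesis .
  qed
  define f where "f x = - cot ((x - z) / 2) - \<eta> * cot (x / 2) ^ k" for x
  define f' where "f' x = inverse ((sin ((x - z) / 2))\<^sup>2) / 2 - \<eta> * w x" for x
  have df: "(f has_real_derivative f' x) (at x)" if "x \<in> D" for x
  proof -
    have "((\<lambda>x. cot ((x - z) / 2)) has_real_derivative - inverse ((sin ((x - z) / 2))\<^sup>2) * (1 / 2)) (at x)"
      by (rule DERIV_chain2[where f = cot and g = "\<lambda>x. (x - z) / 2", OF DERIV_cot[OF s2[OF that]]])
        (auto intro!: derivative_eq_intros)
    from DERIV_diff[OF DERIV_minus[OF this] DERIV_cmult[OF w(2)[OF that], of \<eta>]]
    show ?thesis unfolding f_def f'_def by simp
  qed
  have f'0: "0 \<le> f' x" if "x \<in> D" for x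
  proof -
    have "(sin ((x - z) / 2))\<^sup>2 \<le> 1" by (simp add: abs_square_le_1)
    then have "1 \<le> inverse ((sin ((x - z) / 2))\<^sup>2)"
      using s2[OF that] by (simp add: one_le_inverse_iff)
    then show ?thesis using \<eta>w[OF that] by (simp add: f'_def)
  qed
  have fR: "P' x * f x + (T x + \<eta> * S x) = 0" if "x \<in> D" for x
  proof -
    have "T x = P' x * cot ((x - z) / 2)"
      using T(2)[of x] s2[OF that] by (simp add: cot_def field_simps)
    moreover have "S x = P' x * cot (x / 2) ^ k"
      using S(3)[of x] s1[OF that] by (simp add: cot_def power_divide field_simps)
    ultimately show ?thesis by (simp add: f_def algebra_simps)
  qed
  have "continuous_on D f"
    by (meson DERIV_isCont continuous_at_imp_continuous_on df)
  then have "bounded (f ` D)"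
    by (intro compact_imp_bounded compact_continuous_image cD)
  then obtain F where F: "F > 0" "\<And>x. x \<in> D \<Longrightarrow> \<bar>f x\<bar> \<le> F"
    by (auto simp: bounded_pos)
  \<comment> \<open>\<open>R\<close> continues - P' f across the poles as a trigonometric
    polynomial; by \<open>fR\<close> the two agree on \<open>D\<close>.\<close>
  define R where "R x = T x + \<eta> * S x" for x
  have R: "R \<in> trig n" unfolding R_def by (intro trig_add trig_cmult T S)
  obtain B1 where B1: "B1 > 0" "\<And>x y. \<bar>R x - R y\<bar> \<le> B1 * \<bar>x - y\<bar>"
    by (rule trig_lipschitz[OF R]) blast
  obtain B2 where B2: "B2 > 0" "\<And>x h. \<bar>P (x + h) - P x - P' x * h\<bar> \<le> B2 * h\<^sup>2"
    by (rule trig_taylor[OF P P' der]) blast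
  \<comment> \<open>The coefficient of \<epsilon>^2 in the error at a displaced point: the Taylor
    remainder of \<open>P\<close>, plus \<epsilon> times the change of \<open>R\<close> between
    \<open>x\<close> and \<open>g x\<close>.\<close>
  define C where "C = B2 * F\<^sup>2 + B1 * F"
  have C: "C > 0" using B1(1) B2(1) F(1) by (simp add: C_def add_pos_pos)
  \<comment> \<open>The first bound keeps displacements below \<open>\<delta>\<close>, so that no
    point crosses a pole. The second makes the gain \<epsilon> \<eta> S(0) outweigh the loss P(0) C
    \<epsilon>^2 due to rescaling.\<close>
  define \<epsilon> where "\<epsilon> = min (\<delta> / (2 * F)) (\<eta> * S 0 / (2 * P 0 * C))"
  have \<epsilon>: "\<epsilon> > 0" using \<delta> F(1) \<eta>S P0 C by (simp add: \<epsilon>_def)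
  have "\<epsilon> * F \<le> \<delta> / (2 * F) * F" using F(1) by (intro mult_right_mono) (auto simp: \<epsilon>_def)
  then have \<epsilon>F: "\<epsilon> * F < \<delta>" using F(1) \<delta> by simp
  have "\<epsilon> * (P 0 * C) \<le> \<eta> * S 0 / (2 * P 0 * C) * (P 0 * C)"
    using P0 C by (intro mult_right_mono) (auto simp: \<epsilon>_def)
  also have "\<dots> = \<eta> * S 0 / 2" using P0 C by (simp add: field_simps)
  finally have \<epsilon>C: "\<epsilon> * (P 0 * C) < \<eta> * S 0" using \<eta>S by simp
  define g where "g x = x + \<epsilon> * f x" for x
  have gx: "\<bar>g x - x\<bar> < \<delta>" if "x \<in> D" for x
  proof -
    have "\<bar>g x - x\<bar> = \<epsilon> * \<bar>f x\<bar>" using \<epsilon> by (simp add: g_def abs_mult)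
    also have "\<dots> \<le> \<epsilon> * F" using F(2)[OF that] \<epsilon> by simp
    finally show ?thesis using \<epsilon>F by simp
  qed
  have mono: "g x < g y" if xy: "x < y" "{x..y} \<subseteq> D" for x y
  proof -
    have "f x \<le> f y"
      by (rule DERIV_nonneg_imp_nondecreasing[of x y f]) (use xy df f'0 in force)+
    then have "\<epsilon> * f x \<le> \<epsilon> * f y" using \<epsilon> by simp
    then show ?thesis using xy(1) by (simp add: g_def)
  qed
  \<comment> \<open>The field increases on each of \<open>J1\<close> and \<open>J2\<close> but jumps
    down across its pole \<open>z\<close>. Points on opposite sides of \<open>z\<close> keep their
    order because neither is moved past \<open>z\<close>.\<close>
  have less: "g x < g y" if "x \<in> D" "y \<in> D" "x < y" for x y
  proof (cases "x \<in> J1 \<and> y \<in> J2")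
    case True
    then have "g x < z" "z < g y" using gx[OF that(1)] gx[OF that(2)] by (auto simp: J1_def J2_def)
    then show ?thesis by simp
  next
    case False
    then have "{x..y} \<subseteq> D"
      using that \<delta> by (auto simp: D_def J1_def J2_def)
    then show ?thesis using that mono by blast
  qed
  have inj: "inj_on g D"
    by (rule linorder_inj_onI') (use less in \<open>metis less_irrefl\<close>)
  have grange: "g x \<in> {0..<2*pi}" if "x \<in> D" for x
    using gx[OF that] that \<delta> z by (auto simp: D_def J1_def J2_def)
  \<comment> \<open>The divisor brings the values at the displaced points of \<open>E\<close> back
    to at most 1 in modulus.\<close>
  define Q where "Q x = (1 / (1 + C * \<epsilon>\<^sup>2)) * (P x + \<epsilon> * R x)" for x
  have den: "1 + C * \<epsilon>\<^sup>2 > 0" using C by (simp add: add_pos_nonneg)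
  have Q: "Q \<in> trig n" unfolding Q_def by (intro trig_cmult trig_add P R)
  have gQ: "\<bar>Q (g x)\<bar> \<le> 1" if x: "x \<in> E" for x
  proof -
    have xD: "x \<in> D" using x ED by blast
    have f2: "(f x)\<^sup>2 \<le> F\<^sup>2" using F(2)[OF xD] by (metis abs_ge_zero power2_abs power_mono)
    have "P (g x) + \<epsilon> * R (g x) = P x + (P (x + \<epsilon> * f x) - P x - P' x * (\<epsilon> * f x)) + \<epsilon> * (R (g x) - R x)
       + \<epsilon> * (P' x * f x + (T x + \<eta> * S x))"
      by (simp add: g_def R_def algebra_simps)
    also have "\<dots> = P x + (P (x + \<epsilon> * f x) - P x - P' x * (\<epsilon> * f x)) + \<epsilon> * (R (g x) - R x)"
      by (simp add: fR[OF xD])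
    also have "\<bar>\<dots>\<bar> \<le> \<bar>P x\<bar> + \<bar>P (x + \<epsilon> * f x) - P x - P' x * (\<epsilon> * f x)\<bar> + \<bar>\<epsilon> * (R (g x) - R x)\<bar>"
      by linarith
    also have "\<dots> \<le> 1 + B2 * (\<epsilon> * f x)\<^sup>2 + \<epsilon> * (B1 * (\<epsilon> * \<bar>f x\<bar>))"
    proof (intro add_mono)
      show "\<bar>P x\<bar> \<le> 1" using x by (simp add: E)
      have "\<bar>\<epsilon> * (R (g x) - R x)\<bar> = \<epsilon> * \<bar>R (g x) - R x\<bar>" using \<epsilon> by (simp add: abs_mult)
      also have "\<dots> \<le> \<epsilon> * (B1 * \<bar>g x - x\<bar>)" using B1(2)[of "g x" x] \<epsilon> by simp
      also have "\<bar>g x - x\<bar> = \<epsilon> * \<bar>f x\<bar>" using \<epsilon> by (simp add: g_def abs_mult)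
      finally show "\<bar>\<epsilon> * (R (g x) - R x)\<bar> \<le> \<epsilon> * (B1 * (\<epsilon> * \<bar>f x\<bar>))" .
    qed (rule B2(2))
    also have "\<dots> = 1 + (B2 * (f x)\<^sup>2 + B1 * \<bar>f x\<bar>) * \<epsilon>\<^sup>2"
      by (simp add: algebra_simps power2_eq_square)
    also have "\<dots> \<le> 1 + C * \<epsilon>\<^sup>2"
      unfolding C_def using f2 F(2)[OF xD] B1(1) B2(1)
      by (intro add_left_mono mult_right_mono add_mono mult_left_mono) auto
    finally show ?thesis using den by (simp add: Q_def abs_mult divide_le_eq)
  qed
  have "measure lebesgue E \<le> measure lebesgue (g ` E)"
  proof (rule measure_le_expanding_image[OF cE])
    show "(g has_real_derivative 1 + \<epsilon> * f' x) (at x)" if "x \<in> E" for x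
      unfolding g_def using that ED by (auto intro!: derivative_eq_intros df)
    show "1 \<le> 1 + \<epsilon> * f' x" if "x \<in> E" for x
      using f'0[of x] that ED \<epsilon> by (auto simp: mult_nonneg_nonneg less_imp_le)
    show "inj_on g E" using inj ED by (rule inj_on_subset)
  qed
  also have "\<dots> \<le> measure lebesgue (sublevel Q 1)"
  proof (rule measure_mono_fmeasurable)
    show "g ` E \<subseteq> sublevel Q 1" using gQ grange ED by (auto simp: sublevel_def)
    show "sublevel Q 1 \<in> lmeasurable" by (rule sublevel_lmeasurable[OF trig_continuous[OF Q]])
    have "continuous_on E g"
      unfolding g_def by (intro continuous_intros continuous_on_subset[OF \<open>continuous_on D f\<close> ED])
    then show "g ` E \<in> sets lebesgue"
      by (meson cE compact_continuous_image fmeasurableD lmeasurable_compact)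
  qed
  finally have "measure lebesgue (sublevel P 1) \<le> measure lebesgue (sublevel Q 1)"
    by (simp add: E_def)
  moreover have "P 0 < Q 0"
  proof -
    have "\<epsilon> * (\<epsilon> * (P 0 * C)) < \<epsilon> * (\<eta> * S 0)" using \<epsilon> \<epsilon>C by (rule mult_strict_left_mono[rotated])
    then have "P 0 * (1 + C * \<epsilon>\<^sup>2) < P 0 + \<epsilon> * R 0"
      by (simp add: R_def T0 algebra_simps power2_eq_square)
    then show ?thesis using den by (simp add: Q_def pos_less_divide_eq)
  qed
  ultimately show ?thesis using Q that by blast
qed

subsection \<open>Chebyshev polynomials and Videnskii's inequality on an arc\<close>

text \<open>Replacing the root by its negative swaps the two summands. The freedom permits roots
  other than \<open>csqrt\<close>, such as the real \<open>sinh t\<close> at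
  \<open>cosh t\<close>.\<close>

lemma chebyshev_root:
  fixes w :: complex
  assumes "w\<^sup>2 = of_real (x\<^sup>2 - 1)"
  shows "complex_of_real (chebyshev m x) = ((of_real x + w) ^ m + (of_real x - w) ^ m) / 2"
proof -
  have "(csqrt ((of_real x)\<^sup>2 - 1))\<^sup>2 = w\<^sup>2" using assms by simp
  then have "csqrt ((of_real x)\<^sup>2 - 1) = w \<or> csqrt ((of_real x)\<^sup>2 - 1) = - w"
    by (simp only: power2_eq_iff)
  then show ?thesis unfolding chebyshev_closed_form by auto
qed

text \<open>This parametrises [1, \<infinity>), beyond the reach of the cosine formula, and is the
  source of monotonicity there.\<close>

lemma chebyshev_cosh: "chebyshev m (cosh t) = cosh (real m * t)"
proof -
  have e: "complex_of_real (cosh t) + of_real (sinh t) = of_real (exp t)"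
    "complex_of_real (cosh t) - of_real (sinh t) = of_real (exp (-t))"
    by (simp_all add: cosh_plus_sinh cosh_minus_sinh flip: of_real_add of_real_diff)
  have "(complex_of_real (sinh t))\<^sup>2 = of_real ((cosh t)\<^sup>2 - 1)"
    by (simp add: cosh_square_eq flip: of_real_power)
  from chebyshev_root[OF this, of m]
  have "complex_of_real (chebyshev m (cosh t)) = of_real ((exp t ^ m + exp (-t) ^ m) / 2)"
    unfolding e by simp
  then have "chebyshev m (cosh t) = (exp t ^ m + exp (-t) ^ m) / 2"
    by (simp only: of_real_eq_iff)
  then show ?thesis by (simp add: cosh_def exp_of_nat_mult[symmetric])
qed

text \<open>If w is a root of x^2 - 1, then 2xw is a root of (2x^2 - 1)^2 - 1, and the squares of x
  + w and x - w are (2x^2 - 1) + 2xw and (2x^2 - 1) - 2xw.\<close>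

lemma chebyshev_double: "chebyshev (2 * m) x = chebyshev m (2 * x\<^sup>2 - 1)"
proof -
  define w where "w = csqrt (of_real (x\<^sup>2 - 1))"
  have w: "w\<^sup>2 = of_real (x\<^sup>2 - 1)" by (simp add: w_def)
  have "(2 * of_real x * w)\<^sup>2 = of_real ((2 * x\<^sup>2 - 1)\<^sup>2 - 1)"
    unfolding power_mult_distrib w by (simp add: power2_eq_square algebra_simps)
  note r = chebyshev_root[OF this, of m]
  have "(of_real x + w)\<^sup>2 = of_real (2 * x\<^sup>2 - 1) + 2 * of_real x * w"
    "(of_real x - w)\<^sup>2 = of_real (2 * x\<^sup>2 - 1) - 2 * of_real x * w"
    using w by (simp_all add: power2_sum power2_diff)
  then have "complex_of_real (chebyshev (2 * m) x) = of_real (chebyshev m (2 * x\<^sup>2 - 1))"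
    unfolding r chebyshev_root[OF w] power_mult by simp
  then show ?thesis by (simp only: of_real_eq_iff)
qed

lemma chebyshev_even_minus: "chebyshev (2 * m) (- x) = chebyshev (2 * m) x"
  by (simp add: chebyshev_double)

lemma chebyshev_0: "chebyshev 0 x = 1"
  by (simp add: chebyshev_def)

lemma chebyshev_1: "chebyshev (Suc 0) x = x"
  by (simp add: chebyshev_def)

lemma chebyshev_rec: "chebyshev (Suc (Suc m)) x = 2 * x * chebyshev (Suc m) x - chebyshev m x"
proof -
  define w where "w = csqrt (of_real (x\<^sup>2 - 1))"
  have w: "w\<^sup>2 = of_real (x\<^sup>2 - 1)" by (simp add: w_def)
  define A B where "A = of_real x + w" and "B = of_real x - w"
  have AB: "A + B = 2 * of_real x" "A * B = 1"
    using w by (simp_all add: A_def B_def algebra_simps power2_eq_square)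
  have "A ^ Suc (Suc m) + B ^ Suc (Suc m) = (A + B) * (A ^ Suc m + B ^ Suc m) - (A * B) * (A ^ m + B ^ m)"
    by (simp add: algebra_simps)
  then have "complex_of_real (chebyshev (Suc (Suc m)) x)
      = of_real (2 * x * chebyshev (Suc m) x - chebyshev m x)"
    unfolding AB of_real_diff of_real_mult chebyshev_root[OF w] A_def[symmetric] B_def[symmetric]
    by (simp add: diff_divide_distrib)
  then show ?thesis by (simp only: of_real_eq_iff)
qed

text \<open>The recurrence reaches back two steps, hence the induction on a pair of consecutive
  degrees.\<close>

lemma chebyshev_in_trig:
  assumes "f \<in> trig 1"
  shows "(\<lambda>x. chebyshev m (f x)) \<in> trig m"
proof -
  have "(\<lambda>x. chebyshev m (f x)) \<in> trig m \<and> (\<lambda>x. chebyshev (Suc m) (f x)) \<in> trig (Suc m)"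
  proof (induction m)
    case 0
    then show ?case using assms by (simp add: chebyshev_0 chebyshev_1 trig_const)
  next
    case (Suc m)
    have "(\<lambda>x. 2 * (f x * chebyshev (Suc m) (f x)) - chebyshev m (f x)) \<in> trig (Suc (Suc m))"
      using trig_mult[OF assms conjunct2[OF Suc.IH]] trig_mono_deg[OF conjunct1[OF Suc.IH], of "Suc (Suc m)"]
      by (intro trig_diff trig_cmult) auto
    then show ?case using Suc.IH by (simp add: chebyshev_rec mult.assoc)
  qed
  then show ?thesis ..
qed

lemma chebyshev_strict_mono:
  assumes "0 < m" "1 \<le> x" "x < y"
  shows "chebyshev m x < chebyshev m y"
proof -
  have "arcosh x < arcosh y" using assms by (simp add: arcosh_less_iff_real)
  moreover have "0 \<le> arcosh x" using assms by (simp add: arcosh_nonneg_real)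
  ultimately have "cosh (real m * arcosh x) < cosh (real m * arcosh y)"
    using assms(1) by (intro cosh_real_strict_mono mult_strict_left_mono) auto
  then show ?thesis
    using assms chebyshev_cosh[of m "arcosh x"] chebyshev_cosh[of m "arcosh y"] by (simp add: cosh_arcosh_real)
qed

lemma chebyshev_at_1: "chebyshev m 1 = 1"
  using chebyshev_cos[of m 0] by simp

lemma chebyshev_mono:
  assumes "1 \<le> x" "x \<le> y"
  shows "chebyshev m x \<le> chebyshev m y"
  using assms chebyshev_strict_mono[of m x y] by (cases "m = 0"; cases "x = y") (auto simp: chebyshev_0)

lemma abs_chebyshev_le_1:
  assumes "\<bar>x\<bar> \<le> 1"
  shows "\<bar>chebyshev m x\<bar> \<le> 1"
  using chebyshev_cos[of m "arccos x"] assms by (simp add: cos_arccos_abs)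

lemma abs_chebyshev_even_le:
  assumes "\<bar>x\<bar> \<le> y" "1 \<le> y"
  shows "\<bar>chebyshev (2 * m) x\<bar> \<le> chebyshev (2 * m) y"
proof (cases "\<bar>x\<bar> \<le> 1")
  case True
  then show ?thesis
    using abs_chebyshev_le_1[OF True, of "2 * m"] chebyshev_mono[of 1 y "2 * m"] assms by (simp add: chebyshev_at_1)
next
  case False
  have "chebyshev (2 * m) x = chebyshev (2 * m) \<bar>x\<bar>"
    by (cases "x \<ge> 0") (simp_all add: chebyshev_even_minus)
  then show ?thesis
    using False chebyshev_mono[of 1 "\<bar>x\<bar>" "2 * m"] chebyshev_mono[of "\<bar>x\<bar>" y "2 * m"] assms
    by (simp add: chebyshev_at_1)
qed

lemma one_less_chebyshev_even:
  assumes "0 < m" "1 < \<bar>x\<bar>"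
  shows "1 < chebyshev (2 * m) x"
proof -
  have "chebyshev (2 * m) x = chebyshev (2 * m) \<bar>x\<bar>"
    by (cases "x \<ge> 0") (simp_all add: chebyshev_even_minus)
  then show ?thesis using chebyshev_strict_mono[of "2 * m" 1 "\<bar>x\<bar>"] assms by (simp add: chebyshev_at_1)
qed

text \<open>The extremal polynomial for the arc complementary to the gap of length \<open>s\<close> centred at \<open>c\<close>.\<close>
definition videnskii :: "nat \<Rightarrow> real \<Rightarrow> real \<Rightarrow> real \<Rightarrow> real" where
  "videnskii n s c x = chebyshev (2 * n) (1 / cos (s / 4) * cos ((x - c) / 2))"

text \<open>The half-angle cosine has period 4 pi. The even index 2n lets it enter only through its
  square, a linear function of cos(x - c), to which the Chebyshev polynomial of degree n is
  applied.\<close>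

lemma videnskii_in_trig: "videnskii n s c \<in> trig n"
proof -
  define a where "a = 1 / cos (s / 4)"
  have e: "2 * (a * cos ((x - c) / 2))\<^sup>2 - 1 = a\<^sup>2 * (1 + cos (x - c)) - 1" for x
  proof -
    have "1 + cos (x - c) = 2 * (cos ((x - c) / 2))\<^sup>2"
    proof -
      have h: "2 * ((x - c) / 2) = x - c" by simp
      show ?thesis using cos_double_cos[of "(x - c) / 2"] unfolding h by linarith
    qed
    then show ?thesis by (simp add: power_mult_distrib)
  qed
  have "videnskii n s c = (\<lambda>x. chebyshev n (a\<^sup>2 * (1 + cos (x - c)) - 1))"
    by (rule ext) (simp only: videnskii_def chebyshev_double e flip: a_def)
  also have "\<dots> \<in> trig n"
    by (intro chebyshev_in_trig trig_diff trig_cmult trig_add trig_const cos_in_trig)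
  finally show ?thesis .
qed

text \<open>The points at which the argument of the Chebyshev polynomial equals cos(i pi / (2n)),
  where that polynomial takes the value (-1)^i. The indices 0 and 2n give the two ends of the arc,
  and 2n + 1 nodes are just enough for interpolation.\<close>

definition videnskii_node :: "nat \<Rightarrow> real \<Rightarrow> real \<Rightarrow> nat \<Rightarrow> real" where
  "videnskii_node n s c i = c + 2 * arccos (cos (s / 4) * cos (real i * pi / (2 * n)))"

lemma videnskii_nodes:
  assumes s: "0 < s" "s < 2 * pi" and n: "0 < n"
  shows "strict_mono_on {..2*n} (videnskii_node n s c)"
    and "\<And>i. i \<le> 2 * n \<Longrightarrow> videnskii_node n s c i \<in> {c + s / 2..c + 2 * pi - s / 2}"
    and "\<And>i. i \<le> 2 * n \<Longrightarrow> videnskii n s c (videnskii_node n s c i) = (- 1) ^ i"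
proof -
  define a where "a = cos (s / 4)"
  have a: "0 < a" unfolding a_def using s by (intro cos_gt_zero) auto
  have a1: "a \<le> 1" by (simp add: a_def)
  define u where "u i = a * cos (real i * pi / (2 * n))" for i
  have ang: "0 \<le> real i * pi / (2 * n)" "real i * pi / (2 * n) \<le> pi" if "i \<le> 2 * n" for i
  proof -
    have "real i * pi \<le> (2 * n) * pi" using that by (intro mult_right_mono) auto
    then show "real i * pi / (2 * n) \<le> pi" using n by (simp add: field_simps)
  qed simp
  have u_less: "u j < u i" if "i < j" "j \<le> 2 * n" for i j
  proof -
    have "cos (real j * pi / (2 * n)) < cos (real i * pi / (2 * n))"
      using that ang[of i] ang[of j] n by (intro cos_monotone_0_pi) (auto simp: divide_strict_right_mono)
    then show ?thesis using a by (simp add: u_def)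
  qed
  have ub: "- a \<le> u i" "u i \<le> a" for i
    using a mult_left_mono[of "cos (real i * pi / (2 * n))" 1 a]
      mult_left_mono[of "-1" "cos (real i * pi / (2 * n))" a] by (simp_all add: u_def)
  have ub1: "- 1 \<le> u i" "u i \<le> 1" for i using ub[of i] a1 by auto
  have node: "videnskii_node n s c i = c + 2 * arccos (u i)" for i
    by (simp add: videnskii_node_def u_def a_def)
  show "strict_mono_on {..2*n} (videnskii_node n s c)"
  proof (rule strict_mono_onI)
    fix i j assume "i \<in> {..2*n}" "j \<in> {..2*n}" "i < j"
    then have "arccos (u i) < arccos (u j)"
      using u_less[of i j] ub1 by (intro arccos_less_mono[THEN iffD2]) (auto simp: abs_le_iff minus_le_iff)
    then show "videnskii_node n s c i < videnskii_node n s c j" by (simp add: node)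
  qed
  show "videnskii_node n s c i \<in> {c + s / 2..c + 2 * pi - s / 2}" if "i \<le> 2 * n" for i
  proof -
    have "arccos a = s / 4" unfolding a_def using s by (intro arccos_cos) auto
    moreover have "arccos (- a) = pi - arccos a" using a a1 by (intro arccos_minus) auto
    moreover have "arccos a \<le> arccos (u i)" "arccos (u i) \<le> arccos (- a)"
      using ub[of i] ub1[of i] a a1 by (auto intro!: arccos_le_arccos)
    ultimately show ?thesis by (simp add: node)
  qed
  show "videnskii n s c (videnskii_node n s c i) = (- 1) ^ i" if "i \<le> 2 * n" for i
  proof -
    have "1 / cos (s / 4) * cos ((videnskii_node n s c i - c) / 2) = cos (real i * pi / (2 * n))"
      using ub1[of i] a by (simp add: node a_def[symmetric]) (simp add: u_def)
    then have "videnskii n s c (videnskii_node n s c i) = cos (real (2 * n) * (real i * pi / (2 * n)))"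
      by (simp only: videnskii_def chebyshev_cos)
    also have "real (2 * n) * (real i * pi / (2 * n)) = real i * pi" using n by simp
    finally show ?thesis by (simp only: cos_npi)
  qed
qed

text \<open>The point 0 precedes every node, so all numerators are negative at 0. A denominator is
  positive for j < i and negative for j > i, which leaves exactly i negative factors.\<close>

lemma lagrange_basis_alternates:
  assumes t: "strict_mono_on {..2*n} t" "\<And>i. i \<le> 2 * n \<Longrightarrow> 0 < t i \<and> t i < 2 * pi" and i: "i \<le> 2 * n"
  shows "0 < (- 1) ^ i * lagrange_basis n t i 0"
proof -
  define r where "r j = sin ((0 - t j) / 2) / sin ((t i - t j) / 2)" for j
  have sneg: "sin ((0 - t j) / 2) < 0" if "j \<le> 2 * n" for j
    using t(2)[OF that] sin_gt_zero[of "t j / 2"] by simp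
  have neg: "0 < - r j" if "j \<in> {..<i}" for j
  proof -
    have "t j < t i" using that i t(1) by (auto simp: strict_mono_on_def)
    then have "0 < sin ((t i - t j) / 2)"
      using t(2)[of j] t(2)[of i] that i by (intro sin_gt_zero) auto
    then show ?thesis using sneg[of j] that i by (simp add: r_def divide_neg_pos)
  qed
  have pos: "0 < r j" if "j \<in> {i<..2*n}" for j
  proof -
    have "t i < t j" using that i t(1) by (auto simp: strict_mono_on_def)
    then have "0 < sin ((t j - t i) / 2)"
      using t(2)[of j] t(2)[of i] that i by (intro sin_gt_zero) auto
    moreover have "(t i - t j) / 2 = - ((t j - t i) / 2)" by (simp add: field_simps)
    ultimately have "sin ((t i - t j) / 2) < 0" by (simp only: sin_minus neg_less_0_iff_less)
    then show ?thesis using sneg[of j] that i unfolding r_def by (intro divide_neg_neg) auto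
  qed
  have split: "{..2*n} - {i} = {..<i} \<union> {i<..2*n}" using i by auto
  have "lagrange_basis n t i 0 = prod r ({..<i} \<union> {i<..2*n})"
    unfolding lagrange_basis_def split r_def ..
  also have "\<dots> = prod r {..<i} * prod r {i<..2*n}" by (rule prod.union_disjoint) auto
  finally have "(- 1) ^ i * lagrange_basis n t i 0 = (\<Prod>j<i. - r j) * prod r {i<..2*n}"
    by (simp add: prod_uminus)
  also have "\<dots> > 0" by (intro mult_pos_pos prod_pos) (use neg pos in auto)
  finally show ?thesis .
qed

text \<open>The conditions on \<open>c\<close> say that 0 lies inside the gap of length
  \<open>s\<close> centred at \<open>c\<close>; all nodes then fall into (0, 2 pi), and the basis
  functions alternate in sign at 0.\<close>

lemma videnskii_inequality:
  assumes P: "P \<in> trig n" and n: "0 < n" and s: "0 < s" "s < 2 * pi"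
    and c: "0 < c + s / 2" "c < s / 2"
    and le: "\<And>x. x \<in> {c + s / 2..c + 2 * pi - s / 2} \<Longrightarrow> \<bar>P x\<bar> \<le> 1"
  shows "P 0 \<le> videnskii n s c 0"
    and "P 0 = videnskii n s c 0 \<Longrightarrow> P x = videnskii n s c x"
proof -
  define t where "t = videnskii_node n s c"
  note nodes = videnskii_nodes[OF s n, where c = c, folded t_def]
  have tr: "0 < t i \<and> t i < 2 * pi" if "i \<le> 2 * n" for i
    using nodes(2)[OF that] c by auto
  have ti: "inj_on t {..2*n}" "t ` {..2*n} \<subseteq> {0..<2*pi}"
  proof -
    show "inj_on t {..2*n}" by (rule strict_mono_on_imp_inj_on[OF nodes(1)])
    show "t ` {..2*n} \<subseteq> {0..<2*pi}" using tr by force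
  qed
  define l where "l i = lagrange_basis n t i 0" for i
  have alt: "0 < (- 1) ^ i * l i" if "i \<le> 2 * n" for i
    unfolding l_def using that by (intro lagrange_basis_alternates nodes(1) tr)
  have Pt: "(- 1) ^ i * P (t i) \<le> 1" if "i \<le> 2 * n" for i
    using le[OF nodes(2)[OF that]] by (cases "even i") auto
  \<comment> \<open>The \<open>i\<close>-th term of the interpolated difference at 0, with a sign
    (-1)^i put into each factor so that both become nonnegative. As the second factor is positive, a
    vanishing term fixes \<open>P\<close> at the node.\<close>
  define d where "d i = (1 - (- 1) ^ i * P (t i)) * ((- 1) ^ i * l i)" for i
  have "videnskii n s c (t i) * l i - P (t i) * l i = d i" if "i \<le> 2 * n" for i
    unfolding d_def nodes(3)[OF that] by (cases "even i") (auto simp: algebra_simps)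
  then have "(\<Sum>i\<le>2*n. videnskii n s c (t i) * l i) - (\<Sum>i\<le>2*n. P (t i) * l i) = (\<Sum>i\<le>2*n. d i)"
    unfolding sum_subtractf[symmetric] by (intro sum.cong) auto
  moreover have "videnskii n s c 0 = (\<Sum>i\<le>2*n. videnskii n s c (t i) * l i)"
    unfolding l_def by (rule lagrange_interpolation[OF videnskii_in_trig ti])
  moreover have "P 0 = (\<Sum>i\<le>2*n. P (t i) * l i)"
    unfolding l_def by (rule lagrange_interpolation[OF P ti])
  ultimately have eq: "videnskii n s c 0 - P 0 = (\<Sum>i\<le>2*n. d i)" by linarith
  have nn: "0 \<le> d i" if "i \<in> {..2*n}" for i
    unfolding d_def by (rule mult_nonneg_nonneg) (use Pt[of i] alt[of i] that in auto)
  have "0 \<le> videnskii n s c 0 - P 0" unfolding eq by (rule sum_nonneg[OF nn])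
  then show "P 0 \<le> videnskii n s c 0" by simp
  assume "P 0 = videnskii n s c 0"
  then have "(\<Sum>i\<le>2*n. d i) = 0" using eq by simp
  then have d0: "d i = 0" if "i \<le> 2 * n" for i
    using sum_nonneg_eq_0_iff[of "{..2*n}" d] nn that by auto
  have P1: "(- 1) ^ i * P (t i) = 1" if "i \<le> 2 * n" for i
  proof -
    have "(- 1) ^ i * l i \<noteq> 0" using alt[OF that] by (rule less_imp_neq[THEN not_sym])
    then have "1 - (- 1) ^ i * P (t i) = 0"
      using mult_eq_0_iff[THEN iffD1, OF d0[OF that, unfolded d_def]] by blast
    then show ?thesis by simp
  qed
  have Pti: "P (t i) = (- 1) ^ i" if "i \<le> 2 * n" for i
    using P1[OF that] by (cases "even i") auto
  show "P x = videnskii n s c x"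
  proof (rule trig_cong_points[OF P videnskii_in_trig _ ti(2)])
    show "2 * n < card (t ` {..2*n})" using ti(1) by (simp add: card_image)
    show "P y = videnskii n s c y" if "y \<in> t ` {..2*n}" for y
      using that Pti nodes(3) by auto
  qed simp
qed

subsection \<open>The real inequality\<close>

lemma extremal_sublevel_interval:
  assumes ext: "remez_extremal n L P" and L: "0 < L" and P0: "1 < P 0"
  obtains a b where "0 < a" "a \<le> b" "b < 2 * pi" "sublevel P 1 = {a..b}"
proof -
  have P: "P \<in> trig n" and max: "\<And>x. \<bar>P x\<bar> \<le> P 0" and meas: "L \<le> measure lebesgue (sublevel P 1)"
    and opt: "\<And>f x. f \<in> trig n \<Longrightarrow> L \<le> measure lebesgue (sublevel f 1) \<Longrightarrow> \<bar>f x\<bar> \<le> P 0"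
    using ext unfolding remez_extremal_def by blast+
  obtain P' where P': "P' \<in> trig n" "\<And>x. (P has_real_derivative P' x) (at x)"
    by (rule trig_derivative[OF P]) blast
  define E where "E = sublevel P 1"
  have "E \<noteq> {}" using meas L by (auto simp: E_def)
  then obtain x0 where x0: "\<bar>P x0\<bar> \<le> 1" by (auto simp: E_def sublevel_def)
  have nocrit: "\<bar>P z\<bar> \<le> 1" if z: "0 < z" "z < 2 * pi" "P' z = 0" for z
  proof (rule ccontr)
    assume "\<not> \<bar>P z\<bar> \<le> 1"
    then obtain Q where Q: "Q \<in> trig n" "P 0 < Q 0"
      "measure lebesgue (sublevel P 1) \<le> measure lebesgue (sublevel Q 1)"
      using trig_improve[OF P P' max P0 x0 z] by (metis not_less)
    from opt[OF Q(1), of 0] Q(2,3) meas show False by simp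
  qed
  have per: "P (2 * pi) = P 0" using trig_periodic[OF P, of 0] by simp
  have E: "E = {0..2*pi} \<inter> {x. \<bar>P x\<bar> \<le> 1}"
    using P0 per by (auto simp: E_def sublevel_def order_le_less)
  have "closed {x. \<bar>P x\<bar> \<le> 1}"
    by (intro closed_Collect_le continuous_intros trig_continuous[OF P])
  then have cE: "compact E" unfolding E by (intro compact_Int_closed compact_Icc)
  have notE: "0 \<notin> E" "2 * pi \<notin> E" using P0 per by (auto simp: E)
  have "is_interval E"
    unfolding is_interval_1
  proof (intro ballI allI impI)
    fix u w v assume uw: "u \<in> E" "w \<in> E" and v: "u \<le> v \<and> v \<le> w"
    have range: "0 < u" "w < 2 * pi" using uw notE by (auto simp: E order_le_less)
    have "\<bar>P v\<bar> \<le> 1"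
    proof (rule ccontr)
      assume Pv: "\<not> \<bar>P v\<bar> \<le> 1"
      have "continuous_on {u..w} (\<lambda>x. \<bar>P x\<bar>)"
        by (intro continuous_intros trig_continuous[OF P])
      \<comment> \<open>The maximum of |P| on [u, w] exceeds 1, while both ends lie in
        \<open>E\<close>; so it is attained inside, at a critical point of the forbidden
        kind.\<close>
      then obtain z where z: "z \<in> {u..w}" "\<And>y. y \<in> {u..w} \<Longrightarrow> \<bar>P y\<bar> \<le> \<bar>P z\<bar>"
        using continuous_attains_sup[of "{u..w}" "\<lambda>x. \<bar>P x\<bar>"] v by auto
      have Pz: "1 < \<bar>P z\<bar>" using z(2)[of v] v Pv by auto
      then have "z \<noteq> u" "z \<noteq> w" using uw by (auto simp: E)
      then have zuw: "u < z" "z < w" using z(1) by auto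
      define d where "d = min (z - u) (w - z)"
      have d: "0 < d" using zuw by (simp add: d_def)
      have near: "\<bar>P y\<bar> \<le> \<bar>P z\<bar>" if "\<bar>z - y\<bar> < d" for y
      proof -
        have "y \<in> {u..w}" using that by (auto simp: d_def abs_less_iff)
        then show ?thesis by (rule z(2))
      qed
      have "P' z = 0"
      proof (cases "P z > 0")
        case True
        have "P y \<le> P z" if "\<bar>z - y\<bar> < d" for y using near[OF that] True by simp
        then show ?thesis by (intro DERIV_local_max[OF P'(2) d]) auto
      next
        case False
        have "P z \<le> P y" if "\<bar>z - y\<bar> < d" for y using near[OF that] False by simp
        then show ?thesis by (intro DERIV_local_min[OF P'(2) d]) auto
      qed
      then show False using nocrit[of z] Pz zuw range by simp
    qed
    then show "v \<in> E" using v range by (simp add: E)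
  qed
  then obtain a b where ab: "E = {a..b}"
    using cE is_interval_compact[of E] by auto
  have "a \<le> b" using \<open>E \<noteq> {}\<close> ab by simp
  then have "a \<in> E" "b \<in> E" by (auto simp: ab)
  then have "0 < a" "b < 2 * pi" using notE by (auto simp: E order_le_less)
  then show ?thesis using \<open>a \<le> b\<close> ab that by (simp add: E_def)
qed

lemma cos_quarter_pos:
  assumes "0 < s" "s < 2 * pi"
  shows "0 < cos (s / 4)" "cos (s / 4) < 1"
proof -
  show "0 < cos (s / 4)" using assms by (intro cos_gt_zero) auto
  show "cos (s / 4) < 1" using cos_monotone_0_pi[of 0 "s / 4"] assms by simp
qed

lemma one_less_chebyshev_sec:
  assumes "0 < s" "s < 2 * pi" "0 < n"
  shows "1 < chebyshev (2 * n) (1 / cos (s / 4))"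
  using one_less_chebyshev_even[OF assms(3), of "1 / cos (s / 4)"] cos_quarter_pos[OF assms(1,2)] by simp

text \<open>The gap may be shorter than \<open>s\<close> and need not be centred at 0. Either defect
  can only lower the argument of the Chebyshev polynomial at 0, and strict monotonicity excludes
  both in the case of equality.\<close>

lemma real_remez_extremal:
  assumes n: "0 < n" and s: "0 < s" "s < 2 * pi" and ext: "remez_extremal n (2 * pi - s) P"
  shows "P 0 \<le> chebyshev (2 * n) (1 / cos (s / 4)) \<and>
    (P 0 = chebyshev (2 * n) (1 / cos (s / 4)) \<longrightarrow> P = videnskii n s 0)"
proof (cases "P 0 \<le> 1")
  case True
  then show ?thesis using one_less_chebyshev_sec[OF s n] by simp
next
  case False
  have P: "P \<in> trig n" and meas: "2 * pi - s \<le> measure lebesgue (sublevel P 1)"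
    using ext unfolding remez_extremal_def by blast+
  have "0 < 2 * pi - s" "1 < P 0" using False s by simp_all
  then obtain a b where ab: "0 < a" "a \<le> b" "b < 2 * pi" "sublevel P 1 = {a..b}"
    by (rule extremal_sublevel_interval[OF ext]) blast+
  \<comment> \<open>Modulo 2 pi the gap is (b - 2 pi, a): its length is \<open>s'\<close> and its
    midpoint is the \<open>c\<close> of the next line.\<close>
  define s' where "s' = 2 * pi - (b - a)"
  define c where "c = (a + b) / 2 - pi"
  have s's: "s' \<le> s" using meas ab by (simp add: s'_def)
  have s': "0 < s'" "s' < 2 * pi" using ab s's s by (auto simp: s'_def)
  have ends: "c + s' / 2 = a" "c + 2 * pi - s' / 2 = b" by (simp_all add: c_def s'_def field_simps)
  have c: "0 < c + s' / 2" "c < s' / 2" using ends ab by auto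
  have le: "\<bar>P x\<bar> \<le> 1" if "x \<in> {c + s' / 2..c + 2 * pi - s' / 2}" for x
  proof -
    have "x \<in> sublevel P 1" using that unfolding ends ab(4) .
    then show ?thesis by (simp add: sublevel_def)
  qed
  have V1: "P 0 \<le> videnskii n s' c 0"
    by (rule videnskii_inequality(1)[OF P n s' c]) (rule le)
  have V2: "P x = videnskii n s' c x" if "P 0 = videnskii n s' c 0" for x
    by (rule videnskii_inequality(2)[OF P n s' c _ that]) (rule le)
  define y where "y = 1 / cos (s' / 4) * cos (c / 2)"
  have V0: "videnskii n s' c 0 = chebyshev (2 * n) y"
    by (simp add: videnskii_def y_def)
  note q = cos_quarter_pos[OF s] and q' = cos_quarter_pos[OF s']
  \<comment> \<open>Since 0 lies in the gap, |c| < s'/2. Hence \<open>y \<ge> 1\<close>, the range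
    where the Chebyshev polynomial increases.\<close>
  have "cos (s' / 4) \<le> cos \<bar>c / 2\<bar>"
    using c s' by (intro cos_monotone_0_pi_le) auto
  then have y1: "1 \<le> y" using q' unfolding cos_abs_real by (simp add: y_def)
  have qq: "cos (s / 4) \<le> cos (s' / 4)"
    using s s' s's by (intro cos_monotone_0_pi_le) auto
  have y2: "y \<le> 1 / cos (s' / 4)" using q' by (simp add: y_def divide_right_mono)
  have y3: "1 / cos (s' / 4) \<le> 1 / cos (s / 4)"
    using qq q q' by (intro divide_left_mono) auto
  have le1: "P 0 \<le> chebyshev (2 * n) y" using V1 V0 by simp
  also have le2: "\<dots> \<le> chebyshev (2 * n) (1 / cos (s / 4))"
    using y1 y2 y3 by (intro chebyshev_mono) auto
  finally have "P 0 \<le> chebyshev (2 * n) (1 / cos (s / 4))" .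
  moreover have "P = videnskii n s 0" if eq: "P 0 = chebyshev (2 * n) (1 / cos (s / 4))"
  proof -
    have "\<not> y < 1 / cos (s / 4)"
    proof
      assume "y < 1 / cos (s / 4)"
      then have "chebyshev (2 * n) y < chebyshev (2 * n) (1 / cos (s / 4))"
        using n y1 by (intro chebyshev_strict_mono) auto
      then show False using le1 eq by linarith
    qed
    then have y: "y = 1 / cos (s' / 4)" "1 / cos (s' / 4) = 1 / cos (s / 4)" using y2 y3 by linarith+
    have "cos (c / 2) = 1" using y(1) q' by (simp add: y_def)
    moreover have "cos \<bar>c / 2\<bar> < cos 0" if "c \<noteq> 0"
      using that c s' by (intro cos_monotone_0_pi) auto
    ultimately have "c = 0" unfolding cos_abs_real by force
    have "P 0 = videnskii n s' c 0" unfolding V0 using eq le1 le2 by linarith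
    then have PV: "P x = videnskii n s' c x" for x by (rule V2)
    show ?thesis by (rule HOL.ext) (simp only: PV videnskii_def y(2) \<open>c = 0\<close>)
  qed
  ultimately show ?thesis by blast
qed

text \<open>An extremal polynomial exists and obeys the bound, hence so does every competitor. One
  that attains the bound is then itself extremal and falls under the equality case already
  settled.\<close>

lemma real_remez:
  assumes n: "0 < n" and s: "0 < s" "s < 2 * pi"
    and P: "P \<in> trig n" and max: "\<And>x. \<bar>P x\<bar> \<le> P 0"
    and meas: "2 * pi - s \<le> measure lebesgue (sublevel P 1)"
  shows "P 0 \<le> chebyshev (2 * n) (1 / cos (s / 4))"
    and "P 0 = chebyshev (2 * n) (1 / cos (s / 4)) \<Longrightarrow> P = videnskii n s 0"
proof -
  have L: "0 < 2 * pi - s" "2 * pi - s \<le> 2 * pi" using s by auto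
  obtain P0 where P0: "remez_extremal n (2 * pi - s) P0"
    by (rule remez_extremal_exists[OF L]) blast
  have bound: "\<bar>f x\<bar> \<le> chebyshev (2 * n) (1 / cos (s / 4))"
    if "f \<in> trig n" "2 * pi - s \<le> measure lebesgue (sublevel f 1)" for f x
  proof -
    have "\<bar>f x\<bar> \<le> P0 0" using P0 that unfolding remez_extremal_def by blast
    also have "\<dots> \<le> chebyshev (2 * n) (1 / cos (s / 4))" using real_remez_extremal[OF n s P0] by simp
    finally show ?thesis .
  qed
  show "P 0 \<le> chebyshev (2 * n) (1 / cos (s / 4))" using bound[OF P meas, of 0] by simp
  assume eq: "P 0 = chebyshev (2 * n) (1 / cos (s / 4))"
  then have "remez_extremal n (2 * pi - s) P"
    unfolding remez_extremal_def using P max meas bound by metis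
  then show "P = videnskii n s 0" using real_remez_extremal[OF n s] eq by blast
qed

subsection \<open>Complex trigonometric polynomials\<close>

text \<open>Outside the arc the argument of the Chebyshev polynomial exceeds 1 in modulus. In the
  complex equality case this confines the set where |Q| is at most 1 to the arc.\<close>

lemma abs_videnskii_gt_1:
  assumes n: "0 < n" and s: "0 < s" "s < 2 * pi" and x: "0 \<le> x" "x \<le> 2 * pi"
    and out: "x \<notin> {s / 2..2 * pi - s / 2}"
  shows "1 < \<bar>videnskii n s 0 x\<bar>"
proof -
  note q = cos_quarter_pos[OF s]
  have "cos (s / 4) < \<bar>cos (x / 2)\<bar>"
  proof (cases "x < s / 2")
    case True
    then have "cos (s / 4) < cos (x / 2)" using x s by (intro cos_monotone_0_pi) auto
    then show ?thesis by linarith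
  next
    case False
    then have "cos (s / 4) < cos (pi - x / 2)" using x s out by (intro cos_monotone_0_pi) auto
    then show ?thesis by simp
  qed
  then have "1 < \<bar>1 / cos (s / 4) * cos ((x - 0) / 2)\<bar>" using q by (simp add: abs_mult)
  from one_less_chebyshev_even[OF n this] show ?thesis
    unfolding videnskii_def by linarith
qed

lemma complex_trig_parts:
  fixes Q :: "real \<Rightarrow> complex"
  assumes Q: "\<And>x. Q x = (\<Sum>k\<in>{- int n..int n}. c k * exp (\<i> * of_int k * of_real x))"
  shows "(\<lambda>x. Re (\<alpha> * Q (x + a))) \<in> trig n" and "(\<lambda>x. Im (\<alpha> * Q (x + a))) \<in> trig n"
proof -
  define p where "p = (\<Sum>k\<in>{- int n..int n}. monom (c k) (nat (k + int n)))"
  have degp: "degree p \<le> 2 * n"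
    unfolding p_def by (intro degree_sum_le) (auto intro: order.trans[OF degree_monom_le])
  have p: "Q x * cis x ^ n = poly p (cis x)" for x
  proof -
    have "exp (\<i> * of_int k * of_real x) * cis x ^ n = cis x ^ nat (k + int n)" if "k \<in> {- int n..int n}" for k
    proof -
      have "exp (\<i> * of_int k * of_real x) = cis (of_int k * x)"
        by (simp add: cis_conv_exp mult.assoc)
      moreover have "of_int k * x + real n * x = real (nat (k + int n)) * x"
        using that by (simp add: distrib_right)
      ultimately show ?thesis
        by (simp only: Complex.DeMoivre cis_mult)
    qed
    then show ?thesis
      unfolding Q p_def poly_sum poly_monom sum_distrib_right mult.assoc by (intro sum.cong) auto
  qed
  have Re: "(\<lambda>x. Re (\<beta> * Q (x + a))) \<in> trig n" for \<beta>
  proof -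
    have "(\<lambda>x. Re (\<beta> * Q x)) \<in> trig n"
      by (rule trig_Re[of "smult \<beta> p"]) (use degp in \<open>auto simp: p mult.assoc intro: order.trans[OF degree_smult_le]\<close>)
    then show ?thesis by (rule trig_shift)
  qed
  show "(\<lambda>x. Re (\<alpha> * Q (x + a))) \<in> trig n" by (rule Re)
  show "(\<lambda>x. Im (\<alpha> * Q (x + a))) \<in> trig n"
    using Re[of "- \<i> * \<alpha>"] by simp
qed

text \<open>The inner points where the norm exceeds \<open>l\<close> form an open set of measure
  zero, hence none exist; the end points follow by closure.\<close>

lemma sublevel_fills_interval:
  assumes cont: "continuous_on UNIV f" and uv: "u < v"
    and sub: "sublevel f l \<subseteq> {u..v}" and meas: "v - u \<le> measure lebesgue (sublevel f l)"
    and x: "x \<in> {u..v}"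
  shows "norm (f x) \<le> l"
proof -
  define U where "U = {u<..<v} \<inter> {x. l < norm (f x)}"
  have "open U"
    unfolding U_def by (intro open_Int open_Collect_less continuous_intros cont)
  moreover have Um: "U \<in> lmeasurable"
    using \<open>open U\<close> by (intro bounded_set_imp_lmeasurable)
      (auto simp: U_def intro: bounded_subset[OF bounded_closed_interval[of u v]])
  moreover have "measure lebesgue U \<le> 0"
  proof -
    have disj: "sublevel f l \<inter> U = {}" by (auto simp: sublevel_def U_def)
    have "measure lebesgue (sublevel f l) + measure lebesgue U = measure lebesgue (sublevel f l \<union> U)"
      using disj Um sublevel_lmeasurable[OF cont, of l] by (subst measure_Un3) auto
    also have "\<dots> \<le> measure lebesgue {u..v}"
      using sub Um sublevel_lmeasurable[OF cont, of l]
      by (intro measure_mono_fmeasurable) (auto simp: U_def fmeasurableD)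
    finally show ?thesis using meas uv by simp
  qed
  ultimately have "U = {}"
    using open_not_negligible[of U] negligible_iff_measure[of U] by (metis measure_nonneg order_antisym)
  then have "{u<..<v} \<subseteq> {x. norm (f x) \<le> l}" by (auto simp: U_def not_less)
  moreover have "closed {x. norm (f x) \<le> l}"
    by (intro closed_Collect_le continuous_intros cont)
  ultimately have "closure {u<..<v} \<subseteq> {x. norm (f x) \<le> l}" by (rule closure_minimal)
  then show ?thesis using x uv by auto
qed

lemma complex_remez:
  fixes Q :: "real \<Rightarrow> complex"
  assumes n: "0 < n" and s: "0 < s" "s < 2 * pi"
    and Q: "\<And>x. Q x = (\<Sum>k\<in>{- int n..int n}. c k * exp (\<i> * of_int k * of_real x))"
    and cont: "continuous_on UNIV Q" and per: "\<And>x. Q (x + 2 * pi) = Q x"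
    and meas: "2 * pi - s \<le> measure lebesgue (sublevel Q 1)"
    and max: "\<And>x. norm (Q x) \<le> norm (Q x0)"
  shows "norm (Q x0) \<le> chebyshev (2 * n) (1 / cos (s / 4))"
    and "norm (Q x0) = chebyshev (2 * n) (1 / cos (s / 4)) \<Longrightarrow> Q x = cis (Arg (Q x0)) * of_real (videnskii n s x0 x)"
proof -
  \<comment> \<open>If \<open>Q x0 = 0\<close>, then \<open>sgn\<close> gives \<alpha> = 0; this is
    why only \<open>norm \<alpha> \<le> 1\<close> is recorded. \<open>P\<close> is then zero and the
    inequality still goes through.\<close>
  define \<alpha> where "\<alpha> = cnj (sgn (Q x0))"
  define P where "P x = Re (\<alpha> * Q (x + x0))" for x
  have \<alpha>1: "norm \<alpha> \<le> 1" by (simp add: \<alpha>_def norm_sgn)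
  have cont': "continuous_on UNIV (\<lambda>x. Q (x + x0))"
    by (rule continuous_on_compose2[OF cont]) (auto intro: continuous_intros)
  have P: "P \<in> trig n" unfolding P_def by (rule complex_trig_parts[OF Q])
  have PQ: "\<bar>P x\<bar> \<le> norm (Q (x + x0))" for x
  proof -
    have "\<bar>P x\<bar> \<le> norm \<alpha> * norm (Q (x + x0))"
      unfolding P_def norm_mult[symmetric] by (rule abs_Re_le_cmod)
    also have "\<dots> \<le> 1 * norm (Q (x + x0))" by (rule mult_right_mono[OF \<alpha>1]) simp
    finally show ?thesis by simp
  qed
  have unit: "sgn (Q x0) * \<alpha> = 1" if "Q x0 \<noteq> 0"
    using that complex_norm_square[of "sgn (Q x0)"] by (simp add: \<alpha>_def norm_sgn)
  have P0: "P 0 = norm (Q x0)"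
  proof -
    have "\<alpha> * Q x0 = of_real (norm (Q x0))"
    proof (cases "Q x0 = 0")
      case False
      have "Q x0 = of_real (norm (Q x0)) * sgn (Q x0)" using False by (simp add: sgn_eq)
      then have "\<alpha> * Q x0 = of_real (norm (Q x0)) * (sgn (Q x0) * \<alpha>)" by (metis mult.assoc mult.commute)
      then show ?thesis using unit[OF False] by simp
    qed simp
    then show ?thesis by (simp add: P_def)
  qed
  have Pmax: "\<bar>P x\<bar> \<le> P 0" for x using PQ[of x] max[of "x + x0"] P0 by simp
  have measQ: "2 * pi - s \<le> measure lebesgue (sublevel (\<lambda>x. Q (x + x0)) 1)"
    using meas measure_sublevel_shift[OF cont per, of x0 1] by simp
  also have "\<dots> \<le> measure lebesgue (sublevel P 1)"
    by (rule measure_sublevel_mono[OF cont' trig_continuous[OF P]]) (use PQ in \<open>auto intro: order.trans\<close>)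
  finally have measP: "2 * pi - s \<le> measure lebesgue (sublevel P 1)" .
  note R = real_remez[OF n s P Pmax measP]
  show "norm (Q x0) \<le> chebyshev (2 * n) (1 / cos (s / 4))" using R(1) P0 by simp
  assume eq: "norm (Q x0) = chebyshev (2 * n) (1 / cos (s / 4))"
  have PV: "P = videnskii n s 0" using R(2) P0 eq by simp
  have Q0: "Q x0 \<noteq> 0" using eq one_less_chebyshev_sec[OF s n] by auto
  \<comment> \<open>|P| is dominated by the translated |Q|, so this set lies in the arc belonging to
    \<open>P\<close>. Its measure is at least the length of the arc, so it fills the arc and |Q| is
    controlled at every node.\<close>
  have "sublevel (\<lambda>x. Q (x + x0)) 1 \<subseteq> {s / 2..2 * pi - s / 2}"
  proof
    fix x assume x: "x \<in> sublevel (\<lambda>x. Q (x + x0)) 1"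
    then have "\<bar>videnskii n s 0 x\<bar> \<le> 1" using PQ[of x] by (simp add: PV sublevel_def)
    then show "x \<in> {s / 2..2 * pi - s / 2}"
      using abs_videnskii_gt_1[OF n s, of x] x by (force simp: sublevel_def)
  qed
  then have Qle: "norm (Q (x + x0)) \<le> 1" if "x \<in> {s / 2..2 * pi - s / 2}" for x
    using measQ that s by (intro sublevel_fills_interval[OF cont', of "s / 2" "2 * pi - s / 2"]) auto
  define t where "t = videnskii_node n s 0"
  note nodes = videnskii_nodes[OF s n, where c = 0, folded t_def]
  \<comment> \<open>At a node the real part is 1 or -1, while the modulus is at most 1.\<close>
  have It: "Im (\<alpha> * Q (t i + x0)) = 0" if i: "i \<le> 2 * n" for i
  proof -
    define z where "z = \<alpha> * Q (t i + x0)"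
    have "norm z \<le> 1 * 1"
      unfolding z_def norm_mult using nodes(2)[OF i] \<alpha>1 Qle by (intro mult_mono) auto
    then have "(norm z)\<^sup>2 \<le> 1" by (simp add: power_le_one)
    moreover have "Re z = (- 1) ^ i"
      using nodes(3)[OF i] fun_cong[OF PV, of "t i"] by (simp only: P_def z_def)
    then have "(Re z)\<^sup>2 = 1" by (simp flip: power_mult)
    ultimately have "Im z = 0" by (simp add: cmod_power2)
    then show ?thesis by (simp only: z_def)
  qed
  have tr: "t i \<in> {0..<2*pi}" if "i \<le> 2 * n" for i using nodes(2)[OF that] s by auto
  have Im0: "Im (\<alpha> * Q (x + x0)) = 0" for x
  proof (rule trig_eq_0[OF complex_trig_parts(2)[OF Q], of "t ` {..2*n}"])
    show "2 * n < card (t ` {..2*n})"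
      using strict_mono_on_imp_inj_on[OF nodes(1)] by (simp add: card_image)
    show "t ` {..2*n} \<subseteq> {0..<2*pi}" using tr by blast
    show "Im (\<alpha> * Q (y + x0)) = 0" if "y \<in> t ` {..2*n}" for y using that It by blast
  qed simp
  show "Q x = cis (Arg (Q x0)) * of_real (videnskii n s x0 x)" for x
  proof -
    have "\<alpha> * Q x = of_real (P (x - x0))"
      using Im0[of "x - x0"] by (simp add: P_def complex_eq_iff)
    also have "P (x - x0) = videnskii n s x0 x" by (simp add: PV videnskii_def)
    finally have "sgn (Q x0) * (\<alpha> * Q x) = sgn (Q x0) * of_real (videnskii n s x0 x)" by simp
    then show ?thesis using cis_Arg[OF Q0] unit[OF Q0] by (simp flip: mult.assoc)
  qed
qed

lemma norm_videnskii_max: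
  fixes Q :: "real \<Rightarrow> complex"
  assumes s: "0 < s" "s < 2 * pi" and Q: "\<And>x. Q x = cis c1 * of_real (videnskii n s c0 x)"
  shows "(SUP x\<in>{0..<2*pi}. norm (Q x)) = chebyshev (2 * n) (1 / cos (s / 4))"
proof (rule cSup_eq_maximum)
  note q = cos_quarter_pos[OF s]
  have nQ: "norm (Q x) = \<bar>videnskii n s c0 x\<bar>" for x by (simp add: Q norm_mult)
  have sec: "1 \<le> 1 / cos (s / 4)" using q by simp
  \<comment> \<open>The maximum sits at \<open>c0\<close>, which may lie outside [0, 2 pi); its
    representative there takes the same value.\<close>
  obtain y and k :: int where y: "y \<in> {0..<0 + 2 * pi}" "c0 = y + 2 * pi * k"
    by (rule periodic_representative) blast
  have "videnskii n s c0 c0 = videnskii n s c0 (y + 2 * pi * k)" using y(2) by simp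
  also have "\<dots> = videnskii n s c0 y" by (rule periodic_int) (rule trig_periodic[OF videnskii_in_trig])
  finally have "\<bar>videnskii n s c0 y\<bar> = \<bar>chebyshev (2 * n) (1 / cos (s / 4))\<bar>"
    by (simp add: videnskii_def)
  moreover have "0 \<le> chebyshev (2 * n) (1 / cos (s / 4))"
    using abs_chebyshev_even_le[of 0 "1 / cos (s / 4)" n] sec by linarith
  ultimately have "norm (Q y) = chebyshev (2 * n) (1 / cos (s / 4))" by (simp add: nQ)
  then show "chebyshev (2 * n) (1 / cos (s / 4)) \<in> (\<lambda>x. norm (Q x)) ` {0..<2*pi}"
    using y(1) by (intro image_eqI[of _ _ y]) auto
  fix v assume "v \<in> (\<lambda>x. norm (Q x)) ` {0..<2*pi}"
  then obtain x where v: "v = \<bar>videnskii n s c0 x\<bar>" by (auto simp: nQ)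
  have "\<bar>1 / cos (s / 4) * cos ((x - c0) / 2)\<bar> \<le> 1 / cos (s / 4)"
    using q by (simp add: abs_mult divide_right_mono)
  then show "v \<le> chebyshev (2 * n) (1 / cos (s / 4))"
    unfolding v videnskii_def using sec by (rule abs_chebyshev_even_le)
qed

theorem theorem1p1:
  fixes n :: nat and s :: real and c :: "int \<Rightarrow> complex" and Q :: "real \<Rightarrow> complex"
  assumes "0 < s" and "s < 2 * pi"
    and "\<And>x. Q x = (\<Sum>k\<in>{- int n..int n}. c k * exp (\<i> * of_int k * of_real x))"
    and "measure lebesgue {x \<in> {0..<2 * pi}. norm (Q x) \<le> 1} \<ge> 2 * pi - s"
  shows "(SUP x\<in>{0..<2 * pi}. norm (Q x)) \<le> chebyshev (2 * n) (1 / cos (s / 4)) \<and>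
    ((SUP x\<in>{0..<2 * pi}. norm (Q x)) = chebyshev (2 * n) (1 / cos (s / 4)) \<longleftrightarrow>
      (\<exists>c0 c1 :: real. \<forall>x. Q x = exp (\<i> * of_real c1) *
         of_real (chebyshev (2 * n) (1 / cos (s / 4) * cos ((x - c0) / 2)))))"
proof -
  let ?S = "SUP x\<in>{0..<2 * pi}. norm (Q x)"
  let ?T = "chebyshev (2 * n) (1 / cos (s / 4))"
  let ?form = "\<exists>c0 c1. \<forall>x. Q x = cis c1 * of_real (videnskii n s c0 x)"
  have meas: "2 * pi - s \<le> measure lebesgue (sublevel Q 1)"
    using assms(4) by (simp add: sublevel_def)
  have cont: "continuous_on S Q" for S
    unfolding assms(3)[abs_def] by (intro continuous_intros)
  have per: "Q (x + 2 * pi) = Q x" for x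
    using trig_periodic[OF complex_trig_parts(1)[OF assms(3), of 1 0]]
      trig_periodic[OF complex_trig_parts(2)[OF assms(3), of 1 0]] by (simp add: complex_eq_iff)
  obtain b where b: "b \<in> {0..2*pi}" "\<And>x. x \<in> {0..2*pi} \<Longrightarrow> norm (Q x) \<le> norm (Q b)"
    using continuous_attains_sup[of "{0..2*pi}" "\<lambda>x. norm (Q x)"] continuous_on_norm[OF cont] by auto
  have red: "\<exists>y\<in>{0..<2*pi}. Q x = Q y" for x
  proof -
    obtain y and k :: int where y: "y \<in> {0..<0 + 2 * pi}" "x = y + 2 * pi * k"
      by (rule periodic_representative) blast
    have "Q x = Q y" unfolding y(2) by (rule periodic_int) (rule per)
    then show ?thesis using y by auto
  qed
  obtain x0 where x0: "x0 \<in> {0..<2*pi}" "Q b = Q x0" using red[of b] by blast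
  have max: "norm (Q x) \<le> norm (Q x0)" for x
    using red[of x] b(2) x0 by force
  have S: "?S = norm (Q x0)"
    by (rule cSup_eq_maximum) (use x0(1) max in auto)
  have main: "norm (Q x0) \<le> ?T \<and> (norm (Q x0) = ?T \<longrightarrow> ?form)"
  proof (cases "n = 0")
    case False
    then show ?thesis using complex_remez[OF _ assms(1-3) cont per meas max] by blast
  next
    case True
    \<comment> \<open>Degree 0 is treated directly: the Chebyshev polynomial is then constantly 1,
      so strict monotonicity fails, and the nodes would involve a division by n.\<close>
    then have const: "Q x = c 0" for x by (simp add: assms(3))
    have "sublevel Q 1 \<noteq> {}" using meas assms(2) by auto
    then have "norm (c 0) \<le> 1" by (auto simp: sublevel_def const)
    moreover have "?form" if "norm (c 0) = 1"
    proof -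
      have "c 0 \<noteq> 0" using that by auto
      then have "c 0 = cis (Arg (c 0))" using cis_Arg[of "c 0"] that by (simp add: sgn_div_norm)
      then show ?thesis using True by (auto simp: const videnskii_def chebyshev_0)
    qed
    ultimately show ?thesis using True by (simp add: const chebyshev_0)
  qed
  have conv: "?S = ?T" if ?form
    using that norm_videnskii_max[OF assms(1,2)] by blast
  have "?S \<le> ?T \<and> (?S = ?T \<longleftrightarrow> ?form)" using main conv S by metis
  then show ?thesis by (simp only: videnskii_def cis_conv_exp)
qed

end
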